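(* Let Assumptions 1, 2 and 3 of the context hold for the three-stage DPG method $$u_{n+1}=e^{hJ_n}u_n+hb_1(hJ_n)g_n(u_n)+hb_2(hJ_n)\bigl(g_n(u_{n_2})+C_{n_2}\bigr)+hb_3(hJ_n)g_n(u_{n_3}),$$ $$u_{n_2}=u_n+h\varphi_2(hJ_n)\bigl(g_n(u_n)+J_nu_n\bigr),\qquad u_{n_3}=u_n+hJ_nu_{n_2}+hg_n(u_n),$$ where $C_{n_2}=-\frac14\,g_n'(u_{n_2})(u_{n_3}-2u_{n_2}+u_n)$, started from the exact initial value $u_0$, with coefficients satisfying $$b_1(hJ_n)+b_2(hJ_n)+b_3(hJ_n)=\varphi_1(hJ_n),$$ $$\tfrac14 b_2(hJ_n)+b_3(hJ_n)=2\varphi_3(hJ_n),\qquad \tfrac18 b_2(hJ_n)+b_3(hJ_n)=6\varphi_4(hJ_n).$$ Then the method is fourth-order: the error $e_n=u_n-u(t_n)$ satisfies $$\|e_n\|\le Ch^4$$ uniformly in $t_n$, $0\le t_n\le T$, with a constant $C$ independent of the time-step size $h$.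
   Context: Let $X$ be a Banach space with norm $\|\cdot\|$, $T>0$, and consider $u'(t)=F(u(t))$, $u(0)=u_0$ on $[0,T]$. Assumption 1: $u\in C([0,T);X)\cap C^1((0,T);X)$, and $F:X\to X$ is sufficiently many times Fréchet differentiable in a strip along the exact solution $u$ with all derivatives uniformly bounded; hence the Jacobian $J(v)=\frac{\partial F}{\partial u}(v)$ satisfies $\|J(v)-J(w)\|_{\mathcal L(X)}\le C\|v-w\|$ in a neighborhood of the exact solution. Assumption 2: the linear operator $J=J(v)$ generates a strongly continuous semigroup on $X$, with constants $C,\omega$ such that $\|e^{tJ}\|_{\mathcal L(X)}\le Ce^{\omega t}$, $t\ge0$, uniformly in a neighborhood of the exact solution (i.e. for all $v$ there). Uniform grid: $0=t_0<\dots<t_N=T$, $h=t_{n+1}-t_n$; $u(T)$ is understood by continuity. $u_n\approx u(t_n)$ denotes the numerical solution, $J_n=\frac{\partial F}{\partial u}(u_n)$, $g_n(v)=F(v)-J_nv$, and $g_n'$ is the Fréchet derivative of $g_n$, i.e. $g_n'(v)=J(v)-J_n$ (the scheme is presupposed to be well defined, i.e. these derivatives exist where they are evaluated). The $\varphi$-functions are $\varphi_0(z)=e^z$ and $\varphi_p(z)=\int_0^1e^{(1-\theta)z}\frac{\theta^{p-1}}{(p-1)!}\,d\theta$ for $p\ge1$; applied to $hJ$ via the semigroup $e^{tJ}$. Assumption 3 (stability): there is a constant $C_S$, uniform in $\nu$ and $n$, such that $$\Bigl\|\prod_{k=0}^{n-\nu}e^{hJ_{n-k}}\Bigr\|_{\mathcal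 L(X)}\le C_S,\qquad 0\le t_\nu\le t_n\le T,$$ where the product is $e^{hJ_n}e^{hJ_{n-1}}\cdots e^{hJ_\nu}$. *)

theory Defs
  imports "HOL-Analysis.Analysis"
begin

text \<open>The Frechet derivative as an element of the Banach space \<open>L(X, Y)\<close> of bounded operators,
  so that it can itself be differentiated. Only meaningful where \<open>f\<close> is differentiable.\<close>

definition fderiv :: "('a::real_normed_vector \<Rightarrow> 'b::real_normed_vector) \<Rightarrow> 'a \<Rightarrow> 'a \<Rightarrow>\<^sub>L 'b" where
  "fderiv f v = Blinfun (frechet_derivative f (at v))"

text \<open>Four derivatives is what a local error of order \<open>h ^ 5\<close> needs.\<close>

definition four_times_bounded_differentiable_on ::
    "('a::real_normed_vector \<Rightarrow> 'a) \<Rightarrow> 'a set \<Rightarrow> bool" where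
  "four_times_bounded_differentiable_on F S \<longleftrightarrow>
     (\<forall>v\<in>S. F differentiable (at v) \<and>
            fderiv F differentiable (at v) \<and>
            fderiv (fderiv F) differentiable (at v) \<and>
            fderiv (fderiv (fderiv F)) differentiable (at v)) \<and>
     (\<exists>M. \<forall>v\<in>S. norm (fderiv F v) \<le> M \<and>
                norm (fderiv (fderiv F) v) \<le> M \<and>
                norm (fderiv (fderiv (fderiv F)) v) \<le> M \<and>
                norm (fderiv (fderiv (fderiv (fderiv F))) v) \<le> M)"

definition strip :: "(real \<Rightarrow> 'a::metric_space) \<Rightarrow> real \<Rightarrow> real \<Rightarrow> 'a set" where
  "strip u T r = (\<Union>t\<in>{0..<T}. ball (u t) r)"

text \<open>The Jacobians of a Frechet differentiable \<open>F : X \<rightarrow> X\<close> are bounded operators, so the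
  exponential is given by its (absolutely convergent) power series. The library's \<open>exp\<close> is not
  available here, since the type of bounded operators is not an instance of the class of Banach
  algebras.\<close>

definition op_exp :: "('a::banach \<Rightarrow>\<^sub>L 'a) \<Rightarrow> ('a \<Rightarrow>\<^sub>L 'a)" where
  "op_exp A = (\<Sum>n. ((\<lambda>B. A o\<^sub>L B) ^^ n) id_blinfun /\<^sub>R fact n)"

definition strongly_continuous_semigroup :: "(real \<Rightarrow> ('a::banach \<Rightarrow>\<^sub>L 'a)) \<Rightarrow> bool" where
  "strongly_continuous_semigroup S \<longleftrightarrow>
     S 0 = id_blinfun \<and>
     (\<forall>s\<ge>0. \<forall>t\<ge>0. S (s + t) = S s o\<^sub>L S t) \<and>
     (\<forall>x. continuous_on {0..} (\<lambda>t. blinfun_apply (S t) x))"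

text \<open>As \<open>A\<close> is defined on all of \<open>X\<close>, the domain of the generator of \<open>S\<close> is all of \<open>X\<close>.\<close>

definition generates :: "('a::banach \<Rightarrow>\<^sub>L 'a) \<Rightarrow> (real \<Rightarrow> ('a \<Rightarrow>\<^sub>L 'a)) \<Rightarrow> bool" where
  "generates A S \<longleftrightarrow>
     strongly_continuous_semigroup S \<and>
     (\<forall>x. ((\<lambda>t. (blinfun_apply (S t) x - x) /\<^sub>R t) \<longlongrightarrow> blinfun_apply A x) (at_right 0))"

definition phi :: "nat \<Rightarrow> ('a::banach \<Rightarrow>\<^sub>L 'a) \<Rightarrow> ('a \<Rightarrow>\<^sub>L 'a)" where
  "phi p A =
     (if p = 0 then op_exp A
      else integral {0..1} (\<lambda>\<theta>. (\<theta> ^ (p - 1) / fact (p - 1)) *\<^sub>R op_exp ((1 - \<theta>) *\<^sub>R A)))"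

text \<open>In the following, \<open>w\<close> is the current approximation \<open>u\<^sub>n\<close>, so \<open>J\<^sub>n\<close> is \<open>fderiv F w\<close> and
  \<open>g\<^sub>n\<close> is \<open>nonlin F w\<close>.\<close>

definition nonlin :: "('a::banach \<Rightarrow> 'a) \<Rightarrow> 'a \<Rightarrow> 'a \<Rightarrow> 'a" where
  "nonlin F w v = F v - blinfun_apply (fderiv F w) v"

definition stage2 :: "('a::banach \<Rightarrow> 'a) \<Rightarrow> real \<Rightarrow> 'a \<Rightarrow> 'a" where
  "stage2 F h w =
     w + h *\<^sub>R blinfun_apply (phi 2 (h *\<^sub>R fderiv F w))
                 (nonlin F w w + blinfun_apply (fderiv F w) w)"

definition stage3 :: "('a::banach \<Rightarrow> 'a) \<Rightarrow> real \<Rightarrow> 'a \<Rightarrow> 'a" where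
  "stage3 F h w =
     w + h *\<^sub>R blinfun_apply (fderiv F w) (stage2 F h w) + h *\<^sub>R nonlin F w w"

definition correction2 :: "('a::banach \<Rightarrow> 'a) \<Rightarrow> real \<Rightarrow> 'a \<Rightarrow> 'a" where
  "correction2 F h w =
     - (1/4) *\<^sub>R blinfun_apply (fderiv (nonlin F w) (stage2 F h w))
                   (stage3 F h w - 2 *\<^sub>R stage2 F h w + w)"

definition dpg_step ::
    "('a::banach \<Rightarrow> 'a) \<Rightarrow> (('a \<Rightarrow>\<^sub>L 'a) \<Rightarrow> ('a \<Rightarrow>\<^sub>L 'a)) \<Rightarrow> (('a \<Rightarrow>\<^sub>L 'a) \<Rightarrow> ('a \<Rightarrow>\<^sub>L 'a)) \<Rightarrow>
     (('a \<Rightarrow>\<^sub>L 'a) \<Rightarrow> ('a \<Rightarrow>\<^sub>L 'a)) \<Rightarrow> real \<Rightarrow> 'a \<Rightarrow> 'a" where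
  "dpg_step F b1 b2 b3 h w =
     blinfun_apply (op_exp (h *\<^sub>R fderiv F w)) w
     + h *\<^sub>R blinfun_apply (b1 (h *\<^sub>R fderiv F w)) (nonlin F w w)
     + h *\<^sub>R blinfun_apply (b2 (h *\<^sub>R fderiv F w)) (nonlin F w (stage2 F h w) + correction2 F h w)
     + h *\<^sub>R blinfun_apply (b3 (h *\<^sub>R fderiv F w)) (nonlin F w (stage3 F h w))"

text \<open>\<open>x 0, \<dots>, x N\<close> are the values of a well-defined run of the method: all Jacobians
  \<open>J\<^sub>0, \<dots>, J\<^sub>N\<close> and all derivatives of \<open>g\<^sub>n\<close> entering the corrections exist.\<close>

definition dpg_solution ::
    "('a::banach \<Rightarrow> 'a) \<Rightarrow> (('a \<Rightarrow>\<^sub>L 'a) \<Rightarrow> ('a \<Rightarrow>\<^sub>L 'a)) \<Rightarrow> (('a \<Rightarrow>\<^sub>L 'a) \<Rightarrow> ('a \<Rightarrow>\<^sub>L 'a)) \<Rightarrow>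
     (('a \<Rightarrow>\<^sub>L 'a) \<Rightarrow> ('a \<Rightarrow>\<^sub>L 'a)) \<Rightarrow> 'a \<Rightarrow> real \<Rightarrow> nat \<Rightarrow> (nat \<Rightarrow> 'a) \<Rightarrow> bool" where
  "dpg_solution F b1 b2 b3 u0 h N x \<longleftrightarrow>
     x 0 = u0 \<and>
     (\<forall>n\<le>N. F differentiable (at (x n))) \<and>
     (\<forall>n<N. F differentiable (at (stage2 F h (x n))) \<and>
            x (Suc n) = dpg_step F b1 b2 b3 h (x n))"

definition order_conditions ::
    "(('a::banach \<Rightarrow>\<^sub>L 'a) \<Rightarrow> ('a \<Rightarrow>\<^sub>L 'a)) \<Rightarrow> (('a \<Rightarrow>\<^sub>L 'a) \<Rightarrow> ('a \<Rightarrow>\<^sub>L 'a)) \<Rightarrow>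
     (('a \<Rightarrow>\<^sub>L 'a) \<Rightarrow> ('a \<Rightarrow>\<^sub>L 'a)) \<Rightarrow> ('a \<Rightarrow>\<^sub>L 'a) \<Rightarrow> bool" where
  "order_conditions b1 b2 b3 A \<longleftrightarrow>
     b1 A + b2 A + b3 A = phi 1 A \<and>
     (1/4) *\<^sub>R b2 A + b3 A = 2 *\<^sub>R phi 3 A \<and>
     (1/8) *\<^sub>R b2 A + b3 A = 6 *\<^sub>R phi 4 A"

text \<open>The fold is the product \<open>E n \<dots> E (\<nu> + 1) E \<nu>\<close>, later factors being composed on the left.\<close>

definition stable_products ::
    "('a::banach \<Rightarrow> 'a) \<Rightarrow> real \<Rightarrow> nat \<Rightarrow> real \<Rightarrow> (nat \<Rightarrow> 'a) \<Rightarrow> bool" where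
  "stable_products F h N CS x \<longleftrightarrow>
     (\<forall>\<nu> n. \<nu> \<le> n \<and> n \<le> N \<longrightarrow>
        norm (fold (\<lambda>k P. op_exp (h *\<^sub>R fderiv F (x k)) o\<^sub>L P) [\<nu>..<Suc n] id_blinfun) \<le> CS)"

end

theory Submission
  imports Defs
begin

text \<open>
  Why the method has order four. Let \<open>w\<close> be the current approximation \<open>u\<^sub>n\<close> and write \<open>f\<close>,
  \<open>J\<close>, \<open>H\<close>, \<open>K\<close> for \<open>F\<close> and its first three derivatives at \<open>w\<close>. Both the exact solution and the
  numerical step are expanded about this one point and compared with the same polynomial in
  the time variable (\<open>model\<close> below), rather than with the exact solution
  that starts at \<open>w\<close>.

  The deviation \<open>v s = u (t\<^sub>n + s) - w\<close> of the exact solution satisfies \<open>v' = f + J v + G v\<close>, where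
  \<open>G v = F (w + v) - f - J v\<close> is the nonlinear part. It starts at \<open>v 0 = - e\<^sub>n\<close>. Put
  \<open>\<epsilon> = norm e\<^sub>n\<close>. Since \<open>v s = s f + s\<^sup>2/2 J f\<close> up to \<open>O (h ^ 3 + \<epsilon>)\<close>, Taylor's formula gives
  \<open>G (v s) = s\<^sup>2 a + s\<^sup>3 b\<close> up to \<open>O (h ^ 4 + \<epsilon>)\<close> with
  \<open>a = 1/2 H f f\<close> and \<open>b = 1/2 H f (J f) + 1/6 K f f f\<close>
  (\<open>quad_coeff\<close> and \<open>cubic_coeff\<close>).
  If \<open>G (v s)\<close> were equal to \<open>s\<^sup>2 a + s\<^sup>3 b\<close> and \<open>v 0\<close> to \<open>0\<close>, then \<open>v h\<close> would be
  \<open>h \<phi>\<^sub>1 f + 2 h ^ 3 \<phi>\<^sub>3 a + 6 h ^ 4 \<phi>\<^sub>4 b\<close>, the \<open>\<phi>\<^sub>p\<close> being evaluated at \<open>h J\<close>.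

  On the numerical side the two stages sit at \<open>w + D\<^sub>2\<close> and \<open>w + D\<^sub>3\<close> with
  \<open>D\<^sub>2 = h/2 f + h\<^sup>2/6 J f\<close> and \<open>D\<^sub>3 = h f + h\<^sup>2/2 J f\<close> up to \<open>O (h ^ 3)\<close>. Hence
  \<open>G D\<^sub>3 = h\<^sup>2 a + h ^ 3 b\<close> has the right form, whereas \<open>G D\<^sub>2\<close> has \<open>h ^ 3 / 12\<close> in front of
  \<open>H f (J f)\<close>, instead of the coefficient \<open>h ^ 3 / 16\<close> that it has in \<open>h\<^sup>2/4 a + h ^ 3/8 b\<close>. The
  correction term contributes \<open>- h ^ 3 / 48 H f (J f)\<close> to leading order and repairs this; here the symmetry
  of the second derivative enters. After multiplication by
  \<open>h\<close> and the weights \<open>b\<^sub>2\<close>, \<open>b\<^sub>3\<close>, the order conditions turn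
  the coefficients of \<open>a\<close> and \<open>b\<close> into \<open>2 h ^ 3 \<phi>\<^sub>3\<close> and \<open>6 h ^ 4 \<phi>\<^sub>4\<close>, as they should be.

  Thus \<open>e\<^sub>n\<^sub>+\<^sub>1\<close> is \<open>e\<^sub>n\<close> up to \<open>O (h (h ^ 4 + \<epsilon>))\<close> (\<open>one_step_error\<close>, from \<open>trajectory_expansion\<close>
  and \<open>dpg_step_expansion\<close>), and a discrete Gronwall argument gives \<open>norm e\<^sub>n \<le> exp (C T) h ^ 4\<close>
  for all small \<open>h\<close>; this bound also keeps the numerical solution inside the strip. The
  remaining step sizes \<open>T / N\<close> are finitely many, and each determines its run uniquely, so
  enlarging the constant takes care of them.
\<close>

section \<open>Power series of the exponential and of the \<phi>-functions\<close>

definition op_power :: "('a::real_normed_vector \<Rightarrow>\<^sub>L 'a) \<Rightarrow> nat \<Rightarrow> ('a \<Rightarrow>\<^sub>L 'a)" where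
  "op_power A n = ((\<lambda>B. A o\<^sub>L B) ^^ n) id_blinfun"

lemma op_power_0 [simp]: "op_power A 0 = id_blinfun"
  and op_power_Suc [simp]: "op_power A (Suc n) = A o\<^sub>L op_power A n"
  by (simp_all add: op_power_def)

lemma compose_id_blinfun: "A o\<^sub>L id_blinfun = A"
  by (simp add: blinfun_eqI)

lemma op_power_commute: "A o\<^sub>L op_power A n = op_power A n o\<^sub>L A"
proof (induction n)
  case (Suc n)
  have "A o\<^sub>L op_power A (Suc n) = A o\<^sub>L (op_power A n o\<^sub>L A)"
    using Suc by simp
  then show ?case by (simp add: blinfun_eqI)
qed (simp add: blinfun_eqI)

lemma op_power_scaleR: "op_power (c *\<^sub>R A) n = c ^ n *\<^sub>R op_power A n"
  by (induction n)
     (simp_all add: blinfun.scaleR_left blinfun.scaleR_right blinfun_eqI)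

lemma norm_op_power_le: "norm (op_power A n) \<le> norm A ^ n"
proof (induction n)
  case 0
  then show ?case by (simp add: norm_blinfun_id_le)
next
  case (Suc n)
  have "norm (op_power A (Suc n)) \<le> norm A * norm (op_power A n)"
    by (simp add: norm_blinfun_compose)
  also have "\<dots> \<le> norm A * norm A ^ n"
    using Suc by (rule mult_left_mono) simp
  finally show ?case by simp
qed

text \<open>The \<open>m\<close>-th tail of the exponential series is dominated termwise by \<open>norm A ^ m / fact m\<close> times
  the whole series, because \<open>fact m * fact k \<le> fact (k + m)\<close>.\<close>

lemma op_exp_remainder:
  fixes A :: "'a::banach \<Rightarrow>\<^sub>L 'a"
  shows "norm (op_exp A - (\<Sum>k<m. op_power A k /\<^sub>R fact k)) \<le> norm A ^ m / fact m * exp (norm A)"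
proof -
  let ?a = "\<lambda>k. op_power A k /\<^sub>R fact k"
  have exps: "(\<lambda>k. norm A ^ k / fact k) sums exp (norm A)"
    using exp_converges[of "norm A"] by (simp add: divide_inverse mult.commute)
  have le: "norm (?a k) \<le> norm A ^ k / fact k" for k
    using norm_op_power_le[of A k] by (simp add: divide_inverse mult.commute mult_right_mono)
  have sm: "summable ?a"
    by (rule summable_comparison_test'[OF sums_summable[OF exps], of 0]) (use le in auto)
  have "op_exp A - (\<Sum>k<m. ?a k) = (\<Sum>k. ?a (k + m))"
    using suminf_minus_initial_segment[OF sm, of m] by (simp add: op_exp_def op_power_def)
  also have "norm \<dots> \<le> (\<Sum>k. norm A ^ m / fact m * (norm A ^ k / fact k))"
  proof (rule norm_suminf_le)
    fix k
    have "fact m * fact k \<le> (fact (k + m) :: real)"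
      using fact_fact_dvd_fact[of m k] 
      by (metis add.commute dvd_imp_le fact_gt_zero of_nat_fact of_nat_le_iff of_nat_mult)
    hence "norm A ^ (k + m) / fact (k + m) \<le> norm A ^ (k + m) / (fact m * fact k)"
      by (intro divide_left_mono) auto
    then show "norm (?a (k + m)) \<le> norm A ^ m / fact m * (norm A ^ k / fact k)"
      using le[of "k + m"] by (simp add: power_add mult_ac)
    show "summable (\<lambda>k. norm A ^ m / fact m * (norm A ^ k / fact k))"
      by (intro summable_mult sums_summable[OF exps])
  qed
  also have "\<dots> = norm A ^ m / fact m * exp (norm A)"
    by (rule sums_unique[OF sums_mult[OF exps], symmetric])
  finally show ?thesis .
qed

text \<open>The Beta integral at integer arguments, by repeated integration by parts. It turns the integral
  that defines \<open>\<phi>\<^sub>p\<close> into a power series with coefficients \<open>1 / fact (k + p)\<close>.\<close>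

lemma has_integral_beta:
  "((\<lambda>\<theta>::real. \<theta> ^ q / fact q * ((1 - \<theta>) ^ k / fact k)) has_integral 1 / fact (q + k + 1)) {0..1}"
proof (induction k arbitrary: q)
  case 0
  have "((\<lambda>\<theta>::real. \<theta> ^ q / fact q) has_integral
          (1 ^ Suc q / fact (Suc q) - 0 ^ Suc q / fact (Suc q))) {0..1}"
    by (rule fundamental_theorem_of_calculus)
       (auto intro!: derivative_eq_intros simp del: power_Suc of_nat_Suc
             simp: has_real_derivative_iff_has_vector_derivative[symmetric] field_simps)
  then show ?case by simp
next
  case (Suc k)
  let ?P = "\<lambda>\<theta>::real. \<theta> ^ Suc q / fact (Suc q) * ((1 - \<theta>) ^ Suc k / fact (Suc k))"
  have d: "((\<lambda>x::real. x ^ Suc n / fact (Suc n)) has_real_derivative x ^ n / fact n) (at x within S)" for n x S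
    by (auto intro!: derivative_eq_intros simp del: power_Suc of_nat_Suc simp: field_simps)
  have d': "((\<lambda>x::real. (1 - x) ^ Suc n / fact (Suc n)) has_real_derivative - ((1 - x) ^ n / fact n)) (at x within S)" for n x S
    by (auto intro!: derivative_eq_intros simp del: power_Suc of_nat_Suc simp: field_simps)
  have "((\<lambda>\<theta>::real. \<theta> ^ q / fact q * ((1 - \<theta>) ^ Suc k / fact (Suc k))
            - \<theta> ^ Suc q / fact (Suc q) * ((1 - \<theta>) ^ k / fact k))
          has_integral (?P 1 - ?P 0)) {0..1}"
  proof (rule fundamental_theorem_of_calculus)
    fix x :: real
    show "(?P has_vector_derivative x ^ q / fact q * ((1 - x) ^ Suc k / fact (Suc k))
            - x ^ Suc q / fact (Suc q) * ((1 - x) ^ k / fact k)) (at x within {0..1})"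
      unfolding has_real_derivative_iff_has_vector_derivative[symmetric]
      using DERIV_mult[OF d[of q x "{0..1}"] d'[of k x "{0..1}"]] by (simp add: algebra_simps del: power_Suc fact_Suc)
  qed simp
  from has_integral_add[OF this Suc.IH[of "Suc q"]] show ?case
    by (simp del: power_Suc fact_Suc) 
qed

lemma continuous_on_op_exp_scaleR:
  fixes A :: "'a::banach \<Rightarrow>\<^sub>L 'a"
  shows "continuous_on {0..1::real} (\<lambda>\<theta>. op_exp (\<theta> *\<^sub>R A))"
proof (rule uniform_limit_theorem)
  show "uniform_limit {0..1} (\<lambda>m \<theta>. \<Sum>k<m. op_power (\<theta> *\<^sub>R A) k /\<^sub>R fact k)
          (\<lambda>\<theta>. op_exp (\<theta> *\<^sub>R A)) sequentially"
  proof (rule uniform_limitI)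
    fix e :: real assume "e > 0"
    have "(\<lambda>m. norm A ^ m / fact m * exp (norm A)) \<longlonglongrightarrow> 0 * exp (norm A)"
      using summable_LIMSEQ_zero[OF summable_exp[of "norm A"]]
      by (intro tendsto_mult_right) (simp add: divide_inverse mult.commute)
    hence "\<forall>\<^sub>F m in sequentially. norm A ^ m / fact m * exp (norm A) < e"
      using \<open>e > 0\<close> by (auto dest: order_tendstoD)
    then show "\<forall>\<^sub>F m in sequentially. \<forall>\<theta>\<in>{0..1}.
        dist (\<Sum>k<m. op_power (\<theta> *\<^sub>R A) k /\<^sub>R fact k) (op_exp (\<theta> *\<^sub>R A)) < e"
    proof (rule eventually_mono, intro ballI)
      fix m and \<theta> :: real
      assume m: "norm A ^ m / fact m * exp (norm A) < e" and \<theta>: "\<theta> \<in> {0..1}"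
      have le: "norm (\<theta> *\<^sub>R A) \<le> norm A"
        using \<theta> by (simp add: mult_left_le_one_le)
      have "dist (\<Sum>k<m. op_power (\<theta> *\<^sub>R A) k /\<^sub>R fact k) (op_exp (\<theta> *\<^sub>R A))
          \<le> norm (\<theta> *\<^sub>R A) ^ m / fact m * exp (norm (\<theta> *\<^sub>R A))"
        using op_exp_remainder[of "\<theta> *\<^sub>R A" m] by (simp add: dist_norm norm_minus_commute)
      also have "\<dots> \<le> norm A ^ m / fact m * exp (norm A)"
        using le by (intro mult_mono divide_right_mono power_mono) auto
      finally show "dist (\<Sum>k<m. op_power (\<theta> *\<^sub>R A) k /\<^sub>R fact k) (op_exp (\<theta> *\<^sub>R A)) < e"
        using m by simp
    qed
  qed
  show "\<forall>\<^sub>F m in sequentially. continuous_on {0..1} (\<lambda>\<theta>. \<Sum>k<m. op_power (\<theta> *\<^sub>R A) k /\<^sub>R fact k)"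
    unfolding op_power_scaleR by (intro always_eventually allI continuous_intros)
qed simp

text \<open>The partial sums of the exponential series are integrated exactly by the Beta integral, and since
  the weight \<open>\<theta> ^ (p - 1) / fact (p - 1)\<close> is at most \<open>1\<close> the remainder of \<open>\<phi>\<^sub>p\<close> inherits the bound
  for the exponential.\<close>

lemma phi_remainder:
  fixes A :: "'a::banach \<Rightarrow>\<^sub>L 'a"
  shows "norm (phi p A - (\<Sum>k<m. op_power A k /\<^sub>R fact (k + p))) \<le> norm A ^ m / fact m * exp (norm A)"
proof (cases p)
  case 0
  then show ?thesis using op_exp_remainder[of A m] by (simp add: phi_def)
next
  case (Suc q)
  let ?R = "norm A ^ m / fact m * exp (norm A)"
  let ?w = "\<lambda>\<theta>::real. \<theta> ^ q / fact q"
  let ?S = "\<lambda>\<theta>. \<Sum>k<m. (?w \<theta> * ((1 - \<theta>) ^ k / fact k)) *\<^sub>R op_power A k"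
  have cont: "continuous_on {0..1} (\<lambda>\<theta>. op_exp ((1 - \<theta>) *\<^sub>R A))"
    by (rule continuous_on_compose2[OF continuous_on_op_exp_scaleR]) (auto intro!: continuous_intros)
  have I1: "((\<lambda>\<theta>. ?w \<theta> *\<^sub>R op_exp ((1 - \<theta>) *\<^sub>R A)) has_integral phi p A) {0..1}"
    unfolding phi_def using Suc
    by (auto intro!: integrable_integral integrable_continuous_real continuous_intros cont)
  have I2: "(?S has_integral (\<Sum>k<m. (1 / fact (q + k + 1)) *\<^sub>R op_power A k)) {0..1}"
    by (intro has_integral_sum has_integral_scaleR_left has_integral_beta) auto
  have c: "(\<Sum>k<m. (1 / fact (q + k + 1)) *\<^sub>R op_power A k) = (\<Sum>k<m. op_power A k /\<^sub>R fact (k + p))"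
    using Suc by (intro sum.cong refl) (simp add: divide_inverse add.commute del: fact_Suc)
  have I: "((\<lambda>\<theta>. ?w \<theta> *\<^sub>R op_exp ((1 - \<theta>) *\<^sub>R A) - ?S \<theta>) has_integral
      (phi p A - (\<Sum>k<m. op_power A k /\<^sub>R fact (k + p)))) {0..1}"
    using has_integral_diff[OF I1 I2] unfolding c .
  have "norm (phi p A - (\<Sum>k<m. op_power A k /\<^sub>R fact (k + p))) \<le> ?R * measure lborel {0..1::real}"
  proof (rule has_integral_bound_real[OF _ finite.emptyI I])
    fix \<theta> :: real assume "\<theta> \<in> {0..1} - {}"
    hence \<theta>: "0 \<le> \<theta>" "\<theta> \<le> 1" by auto
    have le: "norm ((1 - \<theta>) *\<^sub>R A) \<le> norm A"
      using \<theta> by (simp add: mult_left_le_one_le)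
    have "?w \<theta> \<le> 1 / 1"
      using \<theta> by (intro frac_le) (auto simp: power_le_one fact_ge_1)
    hence w: "0 \<le> ?w \<theta>" "?w \<theta> \<le> 1" using \<theta> by auto
    have "?w \<theta> *\<^sub>R op_exp ((1 - \<theta>) *\<^sub>R A) - ?S \<theta> =
        ?w \<theta> *\<^sub>R (op_exp ((1 - \<theta>) *\<^sub>R A) - (\<Sum>k<m. op_power ((1 - \<theta>) *\<^sub>R A) k /\<^sub>R fact k))"
      by (simp add: op_power_scaleR scaleR_diff_right scaleR_sum_right divide_inverse mult_ac)
    also have "norm \<dots> \<le> 1 * (norm ((1 - \<theta>) *\<^sub>R A) ^ m / fact m * exp (norm ((1 - \<theta>) *\<^sub>R A)))"
      by (rule order_trans[OF eq_refl[OF norm_scaleR] mult_mono[OF _ op_exp_remainder]])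
         (use w \<theta> in \<open>simp_all add: abs_of_nonneg\<close>)
    also have "\<dots> \<le> 1 * ?R"
      using le by (intro mult_left_mono mult_mono divide_right_mono power_mono) auto
    finally show "norm (?w \<theta> *\<^sub>R op_exp ((1 - \<theta>) *\<^sub>R A) - ?S \<theta>) \<le> ?R" by simp
  qed simp
  then show ?thesis by simp
qed

lemma phi_sums:
  fixes A :: "'a::banach \<Rightarrow>\<^sub>L 'a"
  shows "(\<lambda>k. op_power A k /\<^sub>R fact (k + p)) sums phi p A"
proof -
  have "(\<lambda>m. norm A ^ m / fact m * exp (norm A)) \<longlonglongrightarrow> 0 * exp (norm A)"
    using summable_LIMSEQ_zero[OF summable_exp[of "norm A"]]
    by (intro tendsto_mult_right) (simp add: divide_inverse mult.commute)
  then have "(\<lambda>m. phi p A - (\<Sum>k<m. op_power A k /\<^sub>R fact (k + p))) \<longlonglongrightarrow> 0"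
    by (intro Lim_null_comparison[OF always_eventually[OF allI[OF phi_remainder]]]) simp
  from tendsto_diff[OF tendsto_const[of "phi p A"] this] show ?thesis
    by (simp add: sums_def)
qed

text \<open>The step contains \<open>op_exp (h J) w\<close>. This identity splits off \<open>w\<close> without any remainder, which
  allows a later division by \<open>h\<close>.\<close>

lemma op_exp_eq_phi_1: "op_exp A = id_blinfun + (phi 1 A o\<^sub>L A)"
proof -
  have "(\<lambda>k. (op_power A k /\<^sub>R fact (k + 1)) o\<^sub>L A) sums (phi 1 A o\<^sub>L A)"
    by (rule bounded_linear.sums[OF _ phi_sums])
       (rule bounded_bilinear.bounded_linear_left[OF bounded_bilinear_blinfun_compose])
  moreover have "(op_power A k /\<^sub>R fact (k + 1)) o\<^sub>L A = op_power A (Suc k) /\<^sub>R fact (Suc k)" for k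
    by (simp add: op_power_commute blinfun_eqI blinfun.scaleR_left)
  ultimately have "(\<lambda>k. op_power A (Suc k) /\<^sub>R fact (Suc k)) sums (phi 1 A o\<^sub>L A)"
    by (simp del: op_power_Suc fact_Suc)
  hence "(\<lambda>k. op_power A k /\<^sub>R fact k) sums ((phi 1 A o\<^sub>L A) + op_power A 0 /\<^sub>R fact 0)"
    by (subst (asm) sums_Suc_iff) simp
  moreover have "(\<lambda>k. op_power A k /\<^sub>R fact k) sums op_exp A"
    using phi_sums[where A = A and p = 0] by (simp add: phi_def)
  ultimately show ?thesis by (simp add: sums_unique2 add.commute)
qed

section \<open>Frechet derivatives and Taylor remainders\<close>

lemma has_derivative_fderiv:
  fixes f :: "'a::real_normed_vector \<Rightarrow> 'b::real_normed_vector"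
  assumes "f differentiable (at v)"
  shows "(f has_derivative blinfun_apply (fderiv f v)) (at v)"
proof -
  have d: "(f has_derivative frechet_derivative f (at v)) (at v)"
    using assms by (simp add: frechet_derivative_works)
  then show ?thesis
    unfolding fderiv_def
    by (subst bounded_linear_Blinfun_apply) (auto intro: has_derivative_bounded_linear)
qed

lemma fderiv_eqI:
  assumes "(f has_derivative blinfun_apply A) (at v)"
  shows "fderiv f v = A"
  unfolding fderiv_def frechet_derivative_at[OF assms, symmetric]
  by (rule blinfun_apply_inverse)

text \<open>Subtracting the linear map \<open>J\<^sub>n\<close> subtracts \<open>J\<^sub>n\<close> from the derivative; this is how the correction
  term is evaluated.\<close>

lemma fderiv_nonlin:
  assumes "F differentiable (at v)"
  shows "fderiv (nonlin F w) v = fderiv F v - fderiv F w"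
proof (rule fderiv_eqI)
  have "((\<lambda>v. F v - blinfun_apply (fderiv F w) v) has_derivative
      (\<lambda>x. fderiv F v x - fderiv F w x)) (at v)"
    by (intro derivative_intros has_derivative_fderiv assms) (auto intro!: derivative_eq_intros)
  then show "(nonlin F w has_derivative blinfun_apply (fderiv F v - fderiv F w)) (at v)"
    unfolding nonlin_def[abs_def] minus_blinfun.rep_eq .
qed

lemma has_vector_derivative_along_line:
  assumes "f differentiable (at (w + s *\<^sub>R d))"
  shows "((\<lambda>s. f (w + s *\<^sub>R d)) has_vector_derivative fderiv f (w + s *\<^sub>R d) d) (at s within S)"
proof -
  have "((\<lambda>s. f (w + s *\<^sub>R d)) has_derivative (\<lambda>h. fderiv f (w + s *\<^sub>R d) (h *\<^sub>R d))) (at s within S)"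
    by (rule has_derivative_compose[where g = f and f = "\<lambda>s. w + s *\<^sub>R d"
          and g' = "blinfun_apply (fderiv f (w + s *\<^sub>R d))"])
       (auto intro!: derivative_eq_intros has_derivative_fderiv[OF assms])
  then show ?thesis by (simp add: has_vector_derivative_def blinfun.scaleR_right)
qed

lemma segment_in_ball:
  fixes d :: "'a::real_normed_vector"
  assumes "norm d < \<rho>" "s \<in> {0..1}"
  shows "w + s *\<^sub>R d \<in> ball w \<rho>"
proof -
  have "norm (s *\<^sub>R d) \<le> 1 * norm d"
    unfolding norm_scaleR using assms(2) by (intro mult_right_mono) auto
  then show ?thesis using assms by (simp add: dist_norm)
qed

text \<open>Taylor's formula on the unit interval, with the kernel \<open>(1 - x) ^ (p - 1) / fact (p - 1)\<close> of the
  integral remainder estimated by \<open>1\<close>. Applied to \<open>s \<mapsto> f (w + s d)\<close>, it yields the multivariate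
  remainder estimates below.\<close>

lemma taylor_remainder_along_segment:
  fixes Df :: "nat \<Rightarrow> real \<Rightarrow> 'a::banach"
  assumes "p > 0"
    and "\<And>m t. m < p \<Longrightarrow> t \<in> {0..1} \<Longrightarrow> (Df m has_vector_derivative Df (Suc m) t) (at t within {0..1})"
    and "\<And>t. t \<in> {0..1} \<Longrightarrow> norm (Df p t) \<le> B"
  shows "norm (Df 0 1 - (\<Sum>i<p. Df i 0 /\<^sub>R fact i)) \<le> B"
proof -
  define i where "i = (\<lambda>x::real. ((1 - x) ^ (p - 1) / fact (p - 1)) *\<^sub>R Df p x)"
  have I: "(i has_integral Df 0 1 - (\<Sum>i<p. ((1 - 0) ^ i / fact i) *\<^sub>R Df i 0)) {0..1}"
    unfolding i_def
    by (rule Taylor_has_integral[where f = "Df 0"]) (use assms(1,2) in auto)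
  have "0 \<le> B" using order_trans[OF norm_ge_zero assms(3)[of 0]] by simp
  have "norm (Df 0 1 - (\<Sum>i<p. ((1 - 0) ^ i / fact i) *\<^sub>R Df i 0)) \<le> B * measure lborel {0..1::real}"
  proof (rule has_integral_bound_real[OF \<open>0 \<le> B\<close> finite.emptyI I])
    fix x :: real assume x: "x \<in> {0..1} - {}"
    have "(1 - x) ^ (p - 1) / fact (p - 1) \<le> 1 / 1"
      using x by (intro frac_le) (auto simp: power_le_one fact_ge_1)
    hence "norm (i x) \<le> 1 * B"
      unfolding i_def norm_scaleR using x assms(3)[of x] by (intro mult_mono) auto
    then show "norm (i x) \<le> B" by simp
  qed
  then show ?thesis by (simp add: divide_inverse)
qed

lemma norm_blinfun_apply2: "norm (blinfun_apply (blinfun_apply A x) y) \<le> norm A * norm x * norm y"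
  by (rule order_trans[OF norm_blinfun mult_right_mono[OF norm_blinfun norm_ge_zero]])

lemma norm_blinfun_apply4:
  "norm (blinfun_apply (blinfun_apply (blinfun_apply (blinfun_apply A x) y) z) t)
     \<le> norm A * norm x * norm y * norm z * norm t"
proof -
  have "norm (A x y z t) \<le> norm (A x y) * norm z * norm t" by (rule norm_blinfun_apply2)
  also have "\<dots> \<le> norm A * norm x * norm y * norm z * norm t"
    by (intro mult_right_mono norm_blinfun_apply2) auto
  finally show ?thesis .
qed

lemma norm_diff_le_of_fderiv_bound:
  fixes f :: "'a::real_normed_vector \<Rightarrow> 'b::banach"
  assumes "norm d < \<rho>"
    and "\<And>v. v \<in> ball w \<rho> \<Longrightarrow> f differentiable (at v)"
    and "\<And>v. v \<in> ball w \<rho> \<Longrightarrow> norm (fderiv f v) \<le> M"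
  shows "norm (f (w + d) - f w) \<le> M * norm d"
proof -
  let ?x = "\<lambda>s. w + s *\<^sub>R d"
  let ?Df = "\<lambda>(m::nat) s. if m = 0 then f (?x s) else fderiv f (?x s) d"
  have "norm (?Df 0 1 - (\<Sum>i<1. ?Df i 0 /\<^sub>R fact i)) \<le> M * norm d"
  proof (rule taylor_remainder_along_segment[where Df = ?Df and p = 1])
    fix s :: real assume s: "s \<in> {0..1}"
    note b = segment_in_ball[OF assms(1) s, of w]
    show "norm (?Df 1 s) \<le> M * norm d"
      using order_trans[OF norm_blinfun mult_right_mono[OF assms(3)[OF b] norm_ge_zero]] by simp
    show "(?Df m has_vector_derivative ?Df (Suc m) s) (at s within {0..1})" if "m < 1" for m
      using that has_vector_derivative_along_line[OF assms(2)[OF b]] by simp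
  qed simp
  then show ?thesis by simp
qed

lemma taylor_remainder_order_2:
  fixes f :: "'a::real_normed_vector \<Rightarrow> 'b::banach"
  assumes "norm d < \<rho>"
    and "\<And>v. v \<in> ball w \<rho> \<Longrightarrow> f differentiable (at v)"
    and "\<And>v. v \<in> ball w \<rho> \<Longrightarrow> fderiv f differentiable (at v)"
    and "\<And>v. v \<in> ball w \<rho> \<Longrightarrow> norm (fderiv (fderiv f) v) \<le> M"
  shows "norm (f (w + d) - f w - fderiv f w d) \<le> M * norm d ^ 2"
proof -
  let ?x = "\<lambda>s. w + s *\<^sub>R d"
  let ?Df = "\<lambda>(m::nat) s. if m = 0 then f (?x s) else if m = 1 then fderiv f (?x s) d
                   else fderiv (fderiv f) (?x s) d d"
  have "norm (?Df 0 1 - (\<Sum>i<2. ?Df i 0 /\<^sub>R fact i)) \<le> M * norm d ^ 2"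
  proof (rule taylor_remainder_along_segment[where Df = ?Df and p = 2])
    fix s :: real assume s: "s \<in> {0..1}"
    note b = segment_in_ball[OF assms(1) s, of w]
    have "norm (fderiv (fderiv f) (?x s) d d) \<le> norm (fderiv (fderiv f) (?x s)) * norm d * norm d"
      by (rule norm_blinfun_apply2)
    also have "\<dots> \<le> M * norm d * norm d"
      using assms(4)[OF b] by (intro mult_right_mono) auto
    finally show "norm (?Df 2 s) \<le> M * norm d ^ 2" by (simp add: power2_eq_square)
    show "(?Df m has_vector_derivative ?Df (Suc m) s) (at s within {0..1})" if "m < 2" for m
    proof -
      note line = has_vector_derivative_along_line[where d = d and S = "{0..1}"]
      have "m = 0 \<or> m = 1" using that by presburger
      then consider "m = 0" | "m = 1" by blast
      then show ?thesis
      proof cases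
        case 1
        then show ?thesis using line[OF assms(2)[OF b]] by simp
      next
        case 2
        then show ?thesis
          using bounded_linear.has_vector_derivative[OF blinfun.bounded_linear_left
             line[OF assms(3)[OF b]]] by simp
      qed
    qed
  qed simp
  moreover have "sum g {..<2::nat} = g 0 + g 1" for g :: "nat \<Rightarrow> 'b"
    by (simp add: eval_nat_numeral)
  ultimately show ?thesis by (simp add: diff_diff_add)
qed

lemma taylor_remainder_order_4:
  fixes f :: "'a::real_normed_vector \<Rightarrow> 'b::banach"
  assumes "norm d < \<rho>"
    and "\<And>v. v \<in> ball w \<rho> \<Longrightarrow> f differentiable (at v)"
    and "\<And>v. v \<in> ball w \<rho> \<Longrightarrow> fderiv f differentiable (at v)"
    and "\<And>v. v \<in> ball w \<rho> \<Longrightarrow> fderiv (fderiv f) differentiable (at v)"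
    and "\<And>v. v \<in> ball w \<rho> \<Longrightarrow> fderiv (fderiv (fderiv f)) differentiable (at v)"
    and "\<And>v. v \<in> ball w \<rho> \<Longrightarrow> norm (fderiv (fderiv (fderiv (fderiv f))) v) \<le> M"
  shows "norm (f (w + d) - f w - fderiv f w d - (1/2) *\<^sub>R fderiv (fderiv f) w d d
            - (1/6) *\<^sub>R fderiv (fderiv (fderiv f)) w d d d) \<le> M * norm d ^ 4"
proof -
  let ?x = "\<lambda>s. w + s *\<^sub>R d"
  let ?Df = "\<lambda>(m::nat) s. if m = 0 then f (?x s) else if m = 1 then fderiv f (?x s) d
                   else if m = 2 then fderiv (fderiv f) (?x s) d d
                   else if m = 3 then fderiv (fderiv (fderiv f)) (?x s) d d d
                   else fderiv (fderiv (fderiv (fderiv f))) (?x s) d d d d"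
  have "norm (?Df 0 1 - (\<Sum>i<4. ?Df i 0 /\<^sub>R fact i)) \<le> M * norm d ^ 4"
  proof (rule taylor_remainder_along_segment[where Df = ?Df and p = 4])
    fix s :: real assume s: "s \<in> {0..1}"
    note b = segment_in_ball[OF assms(1) s, of w]
    let ?Q = "fderiv (fderiv (fderiv (fderiv f))) (?x s)"
    have "norm (?Q d d d d) \<le> norm ?Q * norm d * norm d * norm d * norm d"
      by (rule norm_blinfun_apply4)
    also have "\<dots> \<le> M * norm d * norm d * norm d * norm d"
      using assms(6)[OF b] by (intro mult_right_mono) auto
    finally show "norm (?Df 4 s) \<le> M * norm d ^ 4" by (simp add: power4_eq_xxxx mult.assoc)
    note lin = bounded_linear.has_vector_derivative[OF blinfun.bounded_linear_left]
    note line = has_vector_derivative_along_line[where d = d and S = "{0..1}"]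
    show "(?Df m has_vector_derivative ?Df (Suc m) s) (at s within {0..1})" if "m < 4" for m
    proof -
      have "m = 0 \<or> m = 1 \<or> m = 2 \<or> m = 3" using that by presburger
      then consider "m = 0" | "m = 1" | "m = 2" | "m = 3" by blast
      then show ?thesis
      proof cases
        case 1
        then show ?thesis using line[OF assms(2)[OF b]] by simp
      next
        case 2
        then show ?thesis using lin[OF line[OF assms(3)[OF b]]] by simp
      next
        case 3
        then show ?thesis using lin[OF lin[OF line[OF assms(4)[OF b]]]] by simp
      next
        case 4
        then show ?thesis using lin[OF lin[OF lin[OF line[OF assms(5)[OF b]]]]] by simp
      qed
    qed
  qed simp
  moreover have "sum g {..<4::nat} = g 0 + g 1 + g 2 + g 3" for g :: "nat \<Rightarrow> 'b"
    by (simp add: eval_nat_numeral)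
  ultimately show ?thesis by (simp add: fact_numeral diff_diff_add inverse_eq_divide)
qed

text \<open>The second difference approximates \<open>f'' w a b\<close>: the map \<open>s \<mapsto> f (w + a + s b) - f (w + s b)\<close> has the
  derivative \<open>(f' (w + a + s b) - f' (w + s b)) b\<close>, which is \<open>f'' w a b\<close> up to two Taylor
  remainders of \<open>f'\<close>.\<close>

lemma fderiv_fderiv_second_difference:
  fixes f :: "'a::real_normed_vector \<Rightarrow> 'b::banach"
  assumes "norm a + norm b < \<rho>"
    and f1: "\<And>v. v \<in> ball w \<rho> \<Longrightarrow> f differentiable (at v)"
    and f2: "\<And>v. v \<in> ball w \<rho> \<Longrightarrow> fderiv f differentiable (at v)"
    and f3: "\<And>v. v \<in> ball w \<rho> \<Longrightarrow> fderiv (fderiv f) differentiable (at v)"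
    and M: "\<And>v. v \<in> ball w \<rho> \<Longrightarrow> norm (fderiv (fderiv (fderiv f)) v) \<le> M"
  shows "norm (f (w + a + b) - f (w + a) - f (w + b) + f w - fderiv (fderiv f) w a b)
           \<le> 2 * M * (norm a + norm b) ^ 2 * norm b"
proof -
  let ?H = "fderiv (fderiv f) w"
  let ?x = "\<lambda>s. (w + a) + s *\<^sub>R b"
  let ?y = "\<lambda>s. w + s *\<^sub>R b"
  have M0: "0 \<le> M"
  proof -
    have "0 < \<rho>" using assms(1) norm_ge_zero[of a] norm_ge_zero[of b] by linarith
    then show ?thesis using order_trans[OF norm_ge_zero M[of w]] by simp
  qed
  let ?Df = "\<lambda>(m::nat) s. if m = 0 then f (?x s) - f (?y s) - s *\<^sub>R ?H a b
                   else fderiv f (?x s) b - fderiv f (?y s) b - ?H a b"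
  have "norm (?Df 0 1 - (\<Sum>i<1. ?Df i 0 /\<^sub>R fact i)) \<le> 2 * M * (norm a + norm b) ^ 2 * norm b"
  proof (rule taylor_remainder_along_segment[where Df = ?Df and p = 1])
    fix s :: real assume s: "s \<in> {0..1}"
    have sb: "norm (s *\<^sub>R b) \<le> 1 * norm b"
      unfolding norm_scaleR using s by (intro mult_right_mono) auto
    have nb: "norm (s *\<^sub>R b) \<le> norm a + norm b" using sb norm_ge_zero[of a] by linarith
    have nab: "norm (a + s *\<^sub>R b) \<le> norm a + norm b"
      using sb norm_triangle_ineq[of a "s *\<^sub>R b"] by linarith
    have lt: "norm (s *\<^sub>R b) < \<rho>" "norm (a + s *\<^sub>R b) < \<rho>"
      using nb nab assms(1) by linarith+
    have y: "?y s \<in> ball w \<rho>" using lt(1) by (simp add: dist_norm)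
    have x: "?x s \<in> ball w \<rho>" using lt(2) norm_minus_cancel[of "a + s *\<^sub>R b"]
      by (simp add: dist_norm)
    let ?E = "\<lambda>d. fderiv f (w + d) - fderiv f w - ?H d"
    have E: "norm (?E d) \<le> M * (norm a + norm b) ^ 2" if "norm d \<le> norm a + norm b" for d
    proof -
      have "norm (?E d) \<le> M * norm d ^ 2"
        using that assms(1) by (intro taylor_remainder_order_2[where \<rho> = \<rho>] f2 f3 M) auto
      also have "\<dots> \<le> M * (norm a + norm b) ^ 2"
        using that M0 by (intro mult_left_mono power_mono) auto
      finally show ?thesis .
    qed
    have "?Df 1 s = (?E (a + s *\<^sub>R b) - ?E (s *\<^sub>R b)) b"
      by (simp add: blinfun.diff_left blinfun.add_left blinfun.add_right algebra_simps)
    also have "norm \<dots> \<le> norm (?E (a + s *\<^sub>R b) - ?E (s *\<^sub>R b)) * norm b"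
      by (rule norm_blinfun)
    also have "\<dots> \<le> (M * (norm a + norm b) ^ 2 + M * (norm a + norm b) ^ 2) * norm b"
      by (intro mult_right_mono order_trans[OF norm_triangle_ineq4] add_mono E nb nab) auto
    finally show "norm (?Df 1 s) \<le> 2 * M * (norm a + norm b) ^ 2 * norm b" by (simp add: algebra_simps)
    show "(?Df m has_vector_derivative ?Df (Suc m) s) (at s within {0..1})" if "m < 1" for m
    proof -
      have "((\<lambda>s. s *\<^sub>R ?H a b) has_vector_derivative ?H a b) (at s within {0..1})"
        by (auto intro!: derivative_eq_intros)
      from has_vector_derivative_diff[OF has_vector_derivative_diff[OF
          has_vector_derivative_along_line[OF f1[OF x]] has_vector_derivative_along_line[OF f1[OF y]]] this]
      show ?thesis using that by simp
    qed
  qed simp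
  then show ?thesis by (simp add: algebra_simps)
qed

text \<open>The second difference is symmetric in \<open>a\<close> and \<open>b\<close>, so after scaling both by \<open>s\<close> the values
  \<open>f'' w a b\<close> and \<open>f'' w b a\<close> differ by at most \<open>O (s)\<close>.\<close>

lemma fderiv_fderiv_symmetric:
  fixes f :: "'a::real_normed_vector \<Rightarrow> 'b::banach"
  assumes "\<rho> > 0"
    and f1: "\<And>v. v \<in> ball w \<rho> \<Longrightarrow> f differentiable (at v)"
    and f2: "\<And>v. v \<in> ball w \<rho> \<Longrightarrow> fderiv f differentiable (at v)"
    and f3: "\<And>v. v \<in> ball w \<rho> \<Longrightarrow> fderiv (fderiv f) differentiable (at v)"
    and M: "\<And>v. v \<in> ball w \<rho> \<Longrightarrow> norm (fderiv (fderiv (fderiv f)) v) \<le> M"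
  shows "fderiv (fderiv f) w a b = fderiv (fderiv f) w b a"
proof -
  let ?H = "fderiv (fderiv f) w"
  let ?n = "norm a + norm b"
  define \<delta> where "\<delta> = norm (?H a b - ?H b a)"
  have small: "\<delta> \<le> s * (2 * M * ?n ^ 3)" if s: "s > 0" "s * ?n < \<rho>" for s
  proof -
    note second_difference = fderiv_fderiv_second_difference[where w = w and \<rho> = \<rho>, OF _ f1 f2 f3 M]
    have na: "norm (s *\<^sub>R a) = s * norm a" and nb: "norm (s *\<^sub>R b) = s * norm b"
      using s by simp_all
    have n: "s * norm a + s * norm b = s * ?n" "s * norm b + s * norm a = s * ?n"
      by (simp_all add: distrib_left)
    have H: "?H (s *\<^sub>R x) (s *\<^sub>R y) = s\<^sup>2 *\<^sub>R ?H x y" for x y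
      by (simp add: blinfun.scaleR_left blinfun.scaleR_right power2_eq_square)
    let ?D = "f (w + s *\<^sub>R a + s *\<^sub>R b) - f (w + s *\<^sub>R a) - f (w + s *\<^sub>R b) + f w"
    have 1: "norm (?D - s\<^sup>2 *\<^sub>R ?H a b) \<le> 2 * M * (s * ?n) ^ 2 * (s * norm b)"
      using second_difference[of "s *\<^sub>R a" "s *\<^sub>R b"] s(2) unfolding H na nb n by blast
    have D: "f (w + s *\<^sub>R b + s *\<^sub>R a) - f (w + s *\<^sub>R b) - f (w + s *\<^sub>R a) + f w = ?D"
      by (simp add: add.assoc add.commute[of "s *\<^sub>R b"])
    have 2: "norm (?D - s\<^sup>2 *\<^sub>R ?H b a) \<le> 2 * M * (s * ?n) ^ 2 * (s * norm a)"
      using second_difference[of "s *\<^sub>R b" "s *\<^sub>R a"] s(2) unfolding H na nb n D by blast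
    have "s\<^sup>2 * \<delta> = norm ((?D - s\<^sup>2 *\<^sub>R ?H b a) - (?D - s\<^sup>2 *\<^sub>R ?H a b))"
      by (simp add: \<delta>_def flip: scaleR_diff_right)
    also have "\<dots> \<le> 2 * M * (s * ?n) ^ 2 * (s * norm a) + 2 * M * (s * ?n) ^ 2 * (s * norm b)"
      by (intro order_trans[OF norm_triangle_ineq4] add_mono 1 2)
    also have "\<dots> = s\<^sup>2 * (s * (2 * M * ?n ^ 3))"
      by (simp add: power2_eq_square power3_eq_cube algebra_simps)
    finally show ?thesis using s by simp
  qed
  have "((\<lambda>s. s * (2 * M * ?n ^ 3)) \<longlongrightarrow> 0 * (2 * M * ?n ^ 3)) (at_right 0)"
    by (intro tendsto_intros)
  moreover have "\<forall>\<^sub>F s in at_right 0. \<delta> \<le> s * (2 * M * ?n ^ 3)"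
  proof -
    have "((\<lambda>s. s * ?n) \<longlongrightarrow> 0 * ?n) (at_right 0)" by (intro tendsto_intros)
    hence "\<forall>\<^sub>F s in at_right 0. s * ?n < \<rho>" using \<open>\<rho> > 0\<close> by (auto dest: order_tendstoD)
    then show ?thesis using eventually_at_right_less[of "0::real"]
      by eventually_elim (auto intro: small)
  qed
  ultimately have "\<delta> \<le> 0 * (2 * M * ?n ^ 3)"
    by (intro tendsto_lowerbound) auto
  then show ?thesis by (simp add: \<delta>_def)
qed

section \<open>Error terms of a given order\<close>

text \<open>All estimates are uniform over a family of steps. An index \<open>i\<close> stands for one step, with step size
  \<open>h i\<close> and initial error \<open>\<epsilon> i\<close>.\<close>

locale error_scale =
  fixes I :: "'i set" and h \<epsilon> :: "'i \<Rightarrow> real"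
  assumes h_pos: "i \<in> I \<Longrightarrow> 0 < h i" and h_le_1: "i \<in> I \<Longrightarrow> h i \<le> 1"
    and eps_nonneg: "i \<in> I \<Longrightarrow> 0 \<le> \<epsilon> i" and eps_le_1: "i \<in> I \<Longrightarrow> \<epsilon> i \<le> 1"
begin

text \<open>Measuring errors by \<open>h ^ k + \<epsilon>\<close> treats the consistency error and the propagated error at once.
  These scales are multiplicative: since \<open>h\<close> and \<open>\<epsilon>\<close> are at most \<open>1\<close>, a product of quantities of
  orders \<open>j\<close> and \<open>k\<close> is of order \<open>j + k\<close>.\<close>

definition of_order :: "nat \<Rightarrow> ('i \<Rightarrow> 'b::real_normed_vector) \<Rightarrow> bool" where
  "of_order k e \<longleftrightarrow> (\<exists>C. \<forall>i\<in>I. norm (e i) \<le> C * (h i ^ k + \<epsilon> i))"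

lemma scale_nonneg: "i \<in> I \<Longrightarrow> 0 \<le> h i ^ k + \<epsilon> i"
  using h_pos[of i] eps_nonneg[of i] by (simp add: less_imp_le)

lemma of_orderE:
  assumes "of_order k e"
  obtains C where "0 \<le> C" "\<And>i. i \<in> I \<Longrightarrow> norm (e i) \<le> C * (h i ^ k + \<epsilon> i)"
proof -
  obtain C where C: "\<And>i. i \<in> I \<Longrightarrow> norm (e i) \<le> C * (h i ^ k + \<epsilon> i)"
    using assms by (auto simp: of_order_def)
  show thesis
  proof (rule that[of "max C 0"])
    fix i assume i: "i \<in> I"
    show "norm (e i) \<le> max C 0 * (h i ^ k + \<epsilon> i)"
      by (rule order_trans[OF C[OF i] mult_right_mono[OF _ scale_nonneg[OF i]]]) simp
  qed simp
qed

lemma of_order_dominated: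
  assumes "of_order k e" and "\<And>i. i \<in> I \<Longrightarrow> norm (x i) \<le> c * norm (e i)" and "0 \<le> c"
  shows "of_order k x"
proof -
  obtain C where C: "\<And>i. i \<in> I \<Longrightarrow> norm (e i) \<le> C * (h i ^ k + \<epsilon> i)"
    using assms(1) by (auto simp: of_order_def)
  have "norm (x i) \<le> (c * C) * (h i ^ k + \<epsilon> i)" if i: "i \<in> I" for i
    using order_trans[OF assms(2)[OF i] mult_left_mono[OF C[OF i] \<open>0 \<le> c\<close>]]
    by (simp add: mult.assoc)
  then show ?thesis by (auto simp: of_order_def)
qed

lemma of_order_cong:
  assumes "of_order k e" and "\<And>i. i \<in> I \<Longrightarrow> x i = e i"
  shows "of_order k x"
  using assms(2) by (intro of_order_dominated[OF assms(1), of _ 1]) auto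

lemma of_order_mono:
  assumes "of_order k e" and "j \<le> k"
  shows "of_order j e"
proof -
  obtain C where C: "0 \<le> C" "\<And>i. i \<in> I \<Longrightarrow> norm (e i) \<le> C * (h i ^ k + \<epsilon> i)"
    using assms(1) by (rule of_orderE) blast
  have "norm (e i) \<le> C * (h i ^ j + \<epsilon> i)" if i: "i \<in> I" for i
  proof -
    have "h i ^ k \<le> h i ^ j"
      using h_pos[OF i] h_le_1[OF i] assms(2) by (intro power_decreasing) auto
    then show ?thesis
      using C(1) by (intro order_trans[OF C(2)[OF i]] mult_left_mono) auto
  qed
  then show ?thesis by (auto simp: of_order_def)
qed

lemma of_order_bounded:
  assumes "\<And>i. i \<in> I \<Longrightarrow> norm (e i) \<le> M"
  shows "of_order 0 e"
proof -
  have "norm (e i) \<le> \<bar>M\<bar> * (h i ^ 0 + \<epsilon> i)" if i: "i \<in> I" for i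
  proof -
    have "norm (e i) \<le> \<bar>M\<bar> * 1" using assms[OF i] by simp
    also have "\<dots> \<le> \<bar>M\<bar> * (h i ^ 0 + \<epsilon> i)" using eps_nonneg[OF i] by (intro mult_left_mono) auto
    finally show ?thesis .
  qed
  then show ?thesis by (auto simp: of_order_def)
qed

lemma of_order_eps:
  assumes "\<And>i. i \<in> I \<Longrightarrow> norm (e i) \<le> \<epsilon> i"
  shows "of_order k e"
proof -
  have "norm (e i) \<le> 1 * (h i ^ k + \<epsilon> i)" if i: "i \<in> I" for i
    using assms[OF i] h_pos[OF i] zero_le_power[of "h i" k] by (simp add: add_increasing)
  then show ?thesis unfolding of_order_def by blast
qed

lemma of_order_add:
  assumes "of_order k e" and "of_order k e'"
  shows "of_order k (\<lambda>i. e i + e' i)"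
proof -
  obtain C where C: "\<And>i. i \<in> I \<Longrightarrow> norm (e i) \<le> C * (h i ^ k + \<epsilon> i)"
    using assms(1) by (auto simp: of_order_def)
  obtain C' where C': "\<And>i. i \<in> I \<Longrightarrow> norm (e' i) \<le> C' * (h i ^ k + \<epsilon> i)"
    using assms(2) by (auto simp: of_order_def)
  have "norm (e i + e' i) \<le> (C + C') * (h i ^ k + \<epsilon> i)" if i: "i \<in> I" for i
    unfolding distrib_right by (rule order_trans[OF norm_triangle_ineq add_mono[OF C[OF i] C'[OF i]]])
  then show ?thesis by (auto simp: of_order_def)
qed

lemma of_order_scaleR_const:
  assumes "of_order k e"
  shows "of_order k (\<lambda>i. c *\<^sub>R e i)"
  by (rule of_order_dominated[OF assms, of _ "\<bar>c\<bar>"]) auto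

lemma of_order_diff:
  assumes "of_order k e" and "of_order k e'"
  shows "of_order k (\<lambda>i. e i - e' i)"
  using of_order_add[OF assms(1) of_order_scaleR_const[OF assms(2), of "- 1"]] by simp

lemma of_order_bilinear:
  assumes "bounded_bilinear B" and "of_order j x" and "of_order k y" and "n \<le> j + k"
  shows "of_order n (\<lambda>i. B (x i) (y i))"
proof -
  interpret bounded_bilinear B by fact
  obtain K where K: "0 \<le> K" "\<And>a b. norm (B a b) \<le> norm a * norm b * K"
    using nonneg_bounded by blast
  obtain C where C: "0 \<le> C" "\<And>i. i \<in> I \<Longrightarrow> norm (x i) \<le> C * (h i ^ j + \<epsilon> i)"
    using assms(2) by (rule of_orderE) blast
  obtain D where D: "0 \<le> D" "\<And>i. i \<in> I \<Longrightarrow> norm (y i) \<le> D * (h i ^ k + \<epsilon> i)"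
    using assms(3) by (rule of_orderE) blast
  have "norm (B (x i) (y i)) \<le> (3 * C * D * K) * (h i ^ (j + k) + \<epsilon> i)" if i: "i \<in> I" for i
  proof -
    have p: "0 \<le> h i ^ m" "h i ^ m \<le> 1" for m
      using h_pos[OF i] h_le_1[OF i] by (auto intro: power_le_one)
    have e: "0 \<le> \<epsilon> i" "\<epsilon> i \<le> 1" using i by (auto intro: eps_nonneg eps_le_1)
    have "h i ^ j * \<epsilon> i \<le> \<epsilon> i" "\<epsilon> i * h i ^ k \<le> \<epsilon> i" "\<epsilon> i * \<epsilon> i \<le> \<epsilon> i" "0 \<le> h i ^ j * h i ^ k"
      using p e by (auto intro: mult_left_le mult_left_le_one_le)
    hence *: "(h i ^ j + \<epsilon> i) * (h i ^ k + \<epsilon> i) \<le> 3 * (h i ^ (j + k) + \<epsilon> i)"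
      by (simp add: algebra_simps power_add)
    have "norm (B (x i) (y i)) \<le> norm (x i) * norm (y i) * K" by (rule K)
    also have "\<dots> \<le> (C * (h i ^ j + \<epsilon> i)) * (D * (h i ^ k + \<epsilon> i)) * K"
      using C D K i by (intro mult_right_mono mult_mono) (auto intro: mult_nonneg_nonneg scale_nonneg)
    also have "\<dots> = (C * D * K) * ((h i ^ j + \<epsilon> i) * (h i ^ k + \<epsilon> i))" by simp
    also have "\<dots> \<le> (C * D * K) * (3 * (h i ^ (j + k) + \<epsilon> i))"
      using C(1) D(1) K(1) by (intro mult_left_mono[OF *]) auto
    finally show ?thesis by (simp add: mult_ac)
  qed
  hence "of_order (j + k) (\<lambda>i. B (x i) (y i))" by (auto simp: of_order_def)
  then show ?thesis using assms(4) by (rule of_order_mono)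
qed

lemmas of_order_apply = of_order_bilinear[OF bounded_bilinear_blinfun_apply]
lemmas of_order_scaleR = of_order_bilinear[OF bounded_bilinear_scaleR]

lemma of_order_power:
  fixes s :: "'i \<Rightarrow> real"
  assumes "of_order j s"
  shows "of_order (j * k) (\<lambda>i. s i ^ k)"
proof (induction k)
  case 0
  show ?case by (simp, rule of_order_bounded[of _ 1]) simp
next
  case (Suc k)
  from of_order_bilinear[OF bounded_bilinear_mult assms Suc.IH]
  show ?case by simp
qed

lemma of_order_h: "of_order 1 h"
  unfolding of_order_def
proof (intro exI ballI)
  fix i assume i: "i \<in> I"
  show "norm (h i) \<le> 1 * (h i ^ 1 + \<epsilon> i)" using h_pos[OF i] eps_nonneg[OF i] by simp
qed

lemma of_order_h_power: "of_order k (\<lambda>i. h i ^ k)"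
  using of_order_power[OF of_order_h, of k] by simp

end

section \<open>Expansion of the numerical step\<close>

text \<open>The points \<open>w i\<close> about which everything is expanded. The bound on \<open>h i\<close> is chosen so that both
  internal stages stay in the ball in which \<open>F\<close> is controlled.\<close>

locale expansion_points = error_scale I h \<epsilon>
  for I :: "'i set" and h \<epsilon> :: "'i \<Rightarrow> real" +
  fixes F :: "'a::banach \<Rightarrow> 'a" and w :: "'i \<Rightarrow> 'a" and M \<rho> :: real
  assumes M_ge_1: "1 \<le> M" and rho_pos: "0 < \<rho>" and rho_le_1: "\<rho> \<le> 1"
    and F_bound: "i \<in> I \<Longrightarrow> norm (F (w i)) \<le> M"
    and differentiable:
      "i \<in> I \<Longrightarrow> v \<in> ball (w i) \<rho> \<Longrightarrow> F differentiable (at v)"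
      "i \<in> I \<Longrightarrow> v \<in> ball (w i) \<rho> \<Longrightarrow> fderiv F differentiable (at v)"
      "i \<in> I \<Longrightarrow> v \<in> ball (w i) \<rho> \<Longrightarrow> fderiv (fderiv F) differentiable (at v)"
      "i \<in> I \<Longrightarrow> v \<in> ball (w i) \<rho> \<Longrightarrow> fderiv (fderiv (fderiv F)) differentiable (at v)"
    and derivative_bound:
      "i \<in> I \<Longrightarrow> v \<in> ball (w i) \<rho> \<Longrightarrow> norm (fderiv F v) \<le> M"
      "i \<in> I \<Longrightarrow> v \<in> ball (w i) \<rho> \<Longrightarrow> norm (fderiv (fderiv F) v) \<le> M"
      "i \<in> I \<Longrightarrow> v \<in> ball (w i) \<rho> \<Longrightarrow> norm (fderiv (fderiv (fderiv F)) v) \<le> M"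
      "i \<in> I \<Longrightarrow> v \<in> ball (w i) \<rho> \<Longrightarrow> norm (fderiv (fderiv (fderiv (fderiv F))) v) \<le> M"
    and h_small: "i \<in> I \<Longrightarrow> 8 * M ^ 2 * h i \<le> \<rho>"
begin

abbreviation f :: "'i \<Rightarrow> 'a" where "f i \<equiv> F (w i)"
abbreviation J :: "'i \<Rightarrow> 'a \<Rightarrow>\<^sub>L 'a" where "J i \<equiv> fderiv F (w i)"
abbreviation H :: "'i \<Rightarrow> 'a \<Rightarrow>\<^sub>L 'a \<Rightarrow>\<^sub>L 'a" where "H i \<equiv> fderiv (fderiv F) (w i)"
abbreviation K :: "'i \<Rightarrow> 'a \<Rightarrow>\<^sub>L 'a \<Rightarrow>\<^sub>L 'a \<Rightarrow>\<^sub>L 'a" where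
  "K i \<equiv> fderiv (fderiv (fderiv F)) (w i)"

text \<open>The coefficients of \<open>s\<^sup>2\<close> and \<open>s\<^sup>3\<close> in \<open>F (w + v) - f - J v\<close> along \<open>v = s f + s\<^sup>2/2 J f\<close>.\<close>

definition quad_coeff :: "'i \<Rightarrow> 'a" where "quad_coeff i = (1/2) *\<^sub>R H i (f i) (f i)"

definition cubic_coeff :: "'i \<Rightarrow> 'a" where
  "cubic_coeff i = (1/2) *\<^sub>R H i (f i) (J i (f i)) + (1/6) *\<^sub>R K i (f i) (f i) (f i)"

lemma center_in_ball: "w i \<in> ball (w i) \<rho>"
  using rho_pos by simp

lemma H_symmetric: "i \<in> I \<Longrightarrow> H i x y = H i y x"
  by (rule fderiv_fderiv_symmetric[where \<rho> = \<rho> and M = M])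
     (use rho_pos differentiable derivative_bound in auto)

lemma of_order_coefficients:
  "of_order 0 f" "of_order 0 J" "of_order 0 H" "of_order 0 K"
  by (rule of_order_bounded[where M = M];
      use F_bound derivative_bound center_in_ball in blast)+

lemma of_order_J: "of_order k x \<Longrightarrow> of_order k (\<lambda>i. J i (x i))"
  by (rule of_order_apply[OF of_order_coefficients(2)]) auto

lemma of_order_H: "of_order j x \<Longrightarrow> of_order k y \<Longrightarrow> n \<le> j + k \<Longrightarrow> of_order n (\<lambda>i. H i (x i) (y i))"
  by (rule of_order_apply[OF of_order_apply[OF of_order_coefficients(3) _ order_refl]]) simp_all

lemma of_order_K:
  "of_order j x \<Longrightarrow> of_order k y \<Longrightarrow> of_order l z \<Longrightarrow> n \<le> j + k + l \<Longrightarrow>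
   of_order n (\<lambda>i. K i (x i) (y i) (z i))"
  by (rule of_order_apply[OF of_order_apply[OF of_order_apply[OF of_order_coefficients(4) _ order_refl] _ order_refl]])
     simp_all

lemma of_order_Jf: "of_order 0 (\<lambda>i. J i (f i))"
  by (intro of_order_J of_order_coefficients)

lemma of_order_quad: "of_order 0 quad_coeff"
  unfolding quad_coeff_def[abs_def]
  by (intro of_order_scaleR_const of_order_H[of 0 _ 0] of_order_coefficients) simp

lemma of_order_cubic: "of_order 0 cubic_coeff"
  unfolding cubic_coeff_def[abs_def]
  by (intro of_order_add of_order_scaleR_const of_order_H[of 0 _ 0] of_order_K[of 0 _ 0 _ 0]
        of_order_coefficients of_order_J) simp_all

lemma of_order_remainder:
  assumes D: "of_order 1 D" "\<And>i. i \<in> I \<Longrightarrow> norm (D i) < \<rho>"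
  shows "of_order 2 (\<lambda>i. F (w i + D i) - f i - J i (D i))"
    and "of_order 2 (\<lambda>i. fderiv F (w i + D i) - J i - H i (D i))"
    and "of_order 4 (\<lambda>i. F (w i + D i) - f i - J i (D i) - (1/2) *\<^sub>R H i (D i) (D i)
                        - (1/6) *\<^sub>R K i (D i) (D i) (D i))"
proof -
  have n: "of_order 1 (\<lambda>i. norm (D i))"
    by (rule of_order_dominated[OF D(1), of _ 1]) auto
  have n2: "of_order 2 (\<lambda>i. norm (D i) ^ 2)" and n4: "of_order 4 (\<lambda>i. norm (D i) ^ 4)"
    using of_order_power[OF n, of 2] of_order_power[OF n, of 4] by simp_all
  have M0: "0 \<le> M" using M_ge_1 by simp
  show "of_order 2 (\<lambda>i. F (w i + D i) - f i - J i (D i))"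
  proof (rule of_order_dominated[OF n2 _ M0])
    fix i assume i: "i \<in> I"
    show "norm (F (w i + D i) - f i - J i (D i)) \<le> M * norm (norm (D i) ^ 2)"
      using taylor_remainder_order_2[OF D(2)[OF i] differentiable(1,2)[OF i] derivative_bound(2)[OF i]] by simp
  qed
  show "of_order 2 (\<lambda>i. fderiv F (w i + D i) - J i - H i (D i))"
  proof (rule of_order_dominated[OF n2 _ M0])
    fix i assume i: "i \<in> I"
    show "norm (fderiv F (w i + D i) - J i - H i (D i)) \<le> M * norm (norm (D i) ^ 2)"
      using taylor_remainder_order_2[OF D(2)[OF i] differentiable(2,3)[OF i] derivative_bound(3)[OF i]] by simp
  qed
  show "of_order 4 (\<lambda>i. F (w i + D i) - f i - J i (D i) - (1/2) *\<^sub>R H i (D i) (D i)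
                        - (1/6) *\<^sub>R K i (D i) (D i) (D i))"
  proof (rule of_order_dominated[OF n4 _ M0])
    fix i assume i: "i \<in> I"
    show "norm (F (w i + D i) - f i - J i (D i) - (1/2) *\<^sub>R H i (D i) (D i)
                        - (1/6) *\<^sub>R K i (D i) (D i) (D i)) \<le> M * norm (norm (D i) ^ 4)"
      using taylor_remainder_order_4[OF D(2)[OF i] differentiable[OF i] derivative_bound(4)[OF i]] by simp
  qed
qed

text \<open>A displacement known up to an error \<open>r\<close> of order three determines the nonlinear part up to order
  four, because it enters at least quadratically: every term containing \<open>r\<close> carries another
  factor of order one. The lemma is used for both stages
  and for the exact solution, with different \<open>\<alpha>\<close> and \<open>\<beta>\<close>.\<close>

lemma nonlinearity_expansion:
  fixes s :: "'i \<Rightarrow> real" and \<alpha> \<beta> :: real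
  assumes D: "of_order 1 D" "\<And>i. i \<in> I \<Longrightarrow> norm (D i) < \<rho>" and s: "of_order 1 s"
    and r: "of_order 3 (\<lambda>i. D i - ((\<alpha> * s i) *\<^sub>R f i + (\<beta> * s i ^ 2) *\<^sub>R J i (f i)))"
  shows "of_order 4 (\<lambda>i. F (w i + D i) - f i - J i (D i) - ((\<alpha>\<^sup>2 * s i ^ 2) *\<^sub>R quad_coeff i
      + s i ^ 3 *\<^sub>R ((\<alpha> * \<beta>) *\<^sub>R H i (f i) (J i (f i)) + (\<alpha> ^ 3 / 6) *\<^sub>R K i (f i) (f i) (f i))))"
proof -
  define p where "p i = (\<alpha> * s i) *\<^sub>R f i" for i
  define d where "d i = p i + (\<beta> * s i ^ 2) *\<^sub>R J i (f i)" for i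
  define r where "r i = D i - d i" for i
  define q where "q i = D i - p i" for i
  have sk: "of_order k (\<lambda>i. s i ^ k)" for k
    using of_order_power[OF s, of k] by simp
  have p: "of_order 1 p"
    unfolding p_def[abs_def] scaleR_scaleR[symmetric]
    by (intro of_order_scaleR_const of_order_scaleR[OF s of_order_coefficients(1)]) simp
  have b: "of_order 2 (\<lambda>i. (\<beta> * s i ^ 2) *\<^sub>R J i (f i))"
    unfolding scaleR_scaleR[symmetric]
    by (intro of_order_scaleR_const of_order_scaleR[OF sk of_order_Jf]) simp
  have d: "of_order 1 d"
    unfolding d_def[abs_def] by (intro of_order_add p of_order_mono[OF b]) simp
  have r: "of_order 3 r"
    using assms(4) by (simp add: r_def[abs_def] d_def p_def)
  have q: "of_order 2 q"
    by (rule of_order_cong[OF of_order_add[OF b of_order_mono[OF r]]])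
       (simp_all add: q_def r_def d_def)
  have "of_order 4 (\<lambda>i. (F (w i + D i) - f i - J i (D i) - (1/2) *\<^sub>R H i (D i) (D i)
                        - (1/6) *\<^sub>R K i (D i) (D i) (D i))
      + (1/2) *\<^sub>R (H i (D i) (r i) + H i (r i) (d i))
      + (1/2 * \<beta>\<^sup>2) *\<^sub>R (s i ^ 4 *\<^sub>R H i (J i (f i)) (J i (f i)))
      + (1/6) *\<^sub>R (K i (q i) (D i) (D i) + K i (p i) (q i) (D i) + K i (p i) (p i) (q i)))"
    by (intro of_order_add of_order_scaleR_const of_order_remainder(3)[OF D]
          of_order_H[OF D(1) r] of_order_H[OF r d] of_order_scaleR[OF sk of_order_H[OF of_order_Jf of_order_Jf]]
          of_order_K[OF q D(1) D(1)] of_order_K[OF p q D(1)] of_order_K[OF p p q]) simp_all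
  then show ?thesis
  proof (rule of_order_cong)
    fix i assume i: "i \<in> I"
    \<comment> \<open>\<open>D = d + r\<close> in the quadratic term, \<open>D = p + q\<close> in the cubic_coeff one.\<close>
    have HD: "H i (D i) (D i) = H i (d i) (d i) + (H i (D i) (r i) + H i (r i) (d i))"
      by (simp add: r_def blinfun.diff_left blinfun.diff_right)
    have KD: "K i (D i) (D i) (D i) = K i (p i) (p i) (p i)
        + (K i (q i) (D i) (D i) + K i (p i) (q i) (D i) + K i (p i) (p i) (q i))"
      by (simp add: q_def blinfun.diff_left blinfun.diff_right)
    have Hd: "H i (d i) (d i) = (2 * \<alpha>\<^sup>2 * s i ^ 2) *\<^sub>R quad_coeff i
        + (2 * \<alpha> * \<beta> * s i ^ 3) *\<^sub>R H i (f i) (J i (f i))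
        + (\<beta>\<^sup>2 * s i ^ 4) *\<^sub>R H i (J i (f i)) (J i (f i))"
      using H_symmetric[OF i, of "J i (f i)" "f i"]
      by (simp add: d_def p_def quad_coeff_def blinfun.add_left blinfun.add_right blinfun.scaleR_left
          blinfun.scaleR_right algebra_simps power2_eq_square power3_eq_cube power4_eq_xxxx
          flip: scaleR_add_left)
    have Kp: "K i (p i) (p i) (p i) = (\<alpha> ^ 3 * s i ^ 3) *\<^sub>R K i (f i) (f i) (f i)"
      by (simp add: p_def blinfun.scaleR_left blinfun.scaleR_right power3_eq_cube mult_ac)
    show "F (w i + D i) - f i - J i (D i) - ((\<alpha>\<^sup>2 * s i ^ 2) *\<^sub>R quad_coeff i
        + s i ^ 3 *\<^sub>R ((\<alpha> * \<beta>) *\<^sub>R H i (f i) (J i (f i)) + (\<alpha> ^ 3 / 6) *\<^sub>R K i (f i) (f i) (f i))) =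
      (F (w i + D i) - f i - J i (D i) - (1/2) *\<^sub>R H i (D i) (D i)
                        - (1/6) *\<^sub>R K i (D i) (D i) (D i))
      + (1/2) *\<^sub>R (H i (D i) (r i) + H i (r i) (d i))
      + (1/2 * \<beta>\<^sup>2) *\<^sub>R (s i ^ 4 *\<^sub>R H i (J i (f i)) (J i (f i)))
      + (1/6) *\<^sub>R (K i (q i) (D i) (D i) + K i (p i) (q i) (D i) + K i (p i) (p i) (q i))"
      unfolding HD KD Hd Kp by (simp add: algebra_simps)
  qed
qed

lemma phi_expansion:
  "of_order m (\<lambda>i. phi p (h i *\<^sub>R J i) - (\<Sum>k<m. (h i ^ k / fact (k + p)) *\<^sub>R op_power (J i) k))"
proof (rule of_order_dominated[OF of_order_h_power])
  fix i assume i: "i \<in> I"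
  have M0: "0 \<le> M" using M_ge_1 by simp
  have h: "0 \<le> h i" "h i \<le> 1" using h_pos[OF i] h_le_1[OF i] by simp_all
  have nA: "norm (h i *\<^sub>R J i) \<le> h i * M"
    using derivative_bound(1)[OF i center_in_ball] h by (simp add: mult_left_mono)
  have hM: "h i * M \<le> M" using h M0 by (simp add: mult_left_le_one_le)
  have "norm (phi p (h i *\<^sub>R J i) - (\<Sum>k<m. op_power (h i *\<^sub>R J i) k /\<^sub>R fact (k + p)))
      \<le> norm (h i *\<^sub>R J i) ^ m / fact m * exp (norm (h i *\<^sub>R J i))"
    by (rule phi_remainder)
  also have "\<dots> \<le> (h i * M) ^ m / 1 * exp M"
    using nA hM M0 h by (intro mult_mono frac_le power_mono) (auto simp: fact_ge_1)
  finally show "norm (phi p (h i *\<^sub>R J i) - (\<Sum>k<m. (h i ^ k / fact (k + p)) *\<^sub>R op_power (J i) k))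
      \<le> (M ^ m * exp M) * norm (h i ^ m)"
    using h by (simp add: op_power_scaleR divide_inverse power_mult_distrib mult_ac)
qed (use M_ge_1 in simp)

lemma of_order_phi: "of_order 0 (\<lambda>i. phi p (h i *\<^sub>R J i))"
  using phi_expansion[of 0 p] by simp

text \<open>The polynomial shared by the exact and the numerical solution: the Taylor polynomial of degree four
  at \<open>0\<close> of the solution of \<open>z' = f + J z + s\<^sup>2 a + s\<^sup>3 b\<close>, \<open>z 0 = 0\<close>, where \<open>a\<close> and \<open>b\<close> are
  \<open>quad_coeff\<close> and \<open>cubic_coeff\<close>.\<close>

definition model :: "'i \<Rightarrow> real \<Rightarrow> 'a" where
  "model i s = s *\<^sub>R f i + (s ^ 2 / 2) *\<^sub>R J i (f i) + (s ^ 3 / 6) *\<^sub>R J i (J i (f i))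
     + (s ^ 4 / 24) *\<^sub>R J i (J i (J i (f i)))
     + (s ^ 3 / 3) *\<^sub>R quad_coeff i + (s ^ 4 / 12) *\<^sub>R J i (quad_coeff i) + (s ^ 4 / 4) *\<^sub>R cubic_coeff i"

lemma stages_near_center:
  assumes "i \<in> I"
  shows "norm (stage2 F (h i) (w i) - w i) < \<rho>" and "norm (stage3 F (h i) (w i) - w i) < \<rho>"
proof -
  let ?D = "stage2 F (h i) (w i) - w i"
  have h: "0 \<le> h i" "h i \<le> 1" using h_pos[OF assms] h_le_1[OF assms] by auto
  have M0: "0 \<le> M" using M_ge_1 by simp
  have M2: "M \<le> M\<^sup>2" using M_ge_1 by (simp add: self_le_power)
  have hM2: "h i * M\<^sup>2 \<le> \<rho> / 8" using h_small[OF assms] by (simp add: mult_ac)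
  have hM: "h i * M \<le> \<rho> / 8" using mult_left_mono[OF M2 h(1)] hM2 by linarith
  have J: "norm (J i) \<le> M" using derivative_bound(1)[OF assms center_in_ball] .
  have nA: "norm (h i *\<^sub>R J i) \<le> 1"
    using mult_left_mono[OF J h(1)] hM rho_le_1 h by simp
  have "norm (phi 2 (h i *\<^sub>R J i)) \<le> exp (norm (h i *\<^sub>R J i))"
    using phi_remainder[of 2 "h i *\<^sub>R J i" 0] by simp
  also have "\<dots> \<le> 3" using nA exp_le by (meson exp_le_cancel_iff order_trans)
  finally have phi: "norm (phi 2 (h i *\<^sub>R J i)) \<le> 3" .
  have D: "?D = h i *\<^sub>R phi 2 (h i *\<^sub>R J i) (f i)"
    by (simp add: stage2_def nonlin_def)
  have "norm (phi 2 (h i *\<^sub>R J i) (f i)) \<le> 3 * M"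
    using phi F_bound[OF assms] by (intro order_trans[OF norm_blinfun] mult_mono) auto
  hence "norm ?D \<le> h i * (3 * M)"
    unfolding D using h by (simp add: mult_left_mono)
  hence D_le: "norm ?D \<le> 3 / 8 * \<rho>" using hM by (simp add: mult_ac)
  then show "norm ?D < \<rho>" using rho_pos by simp
  have D1: "norm ?D \<le> 1" using D_le rho_le_1 by simp
  have "norm (J i ?D) \<le> M * 1"
    using J D1 M0 by (intro order_trans[OF norm_blinfun] mult_mono) auto
  hence "norm (J i ?D + f i) \<le> M + M"
    using F_bound[OF assms] by (intro order_trans[OF norm_triangle_ineq] add_mono) auto
  hence "h i * norm (J i ?D + f i) \<le> h i * (M + M)" using h(1) by (rule mult_left_mono)
  also have "\<dots> \<le> \<rho> / 4" using hM by (simp add: algebra_simps)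
  finally have "h i * norm (J i ?D + f i) \<le> \<rho> / 4" .
  moreover have "stage3 F (h i) (w i) - w i = h i *\<^sub>R (J i ?D + f i)"
    by (simp add: stage3_def nonlin_def blinfun.diff_right algebra_simps)
  ultimately show "norm (stage3 F (h i) (w i) - w i) < \<rho>" using rho_pos h by simp
qed

text \<open>The increment of the method agrees with \<open>model\<close> up to order five. The statement divides by \<open>h\<close>,
  because a term \<open>h \<epsilon>\<close> is harmless in the error recursion whereas a term \<open>\<epsilon>\<close> with an unspecified
  constant is not.\<close>

lemma dpg_step_expansion:
  assumes oc: "\<And>i. i \<in> I \<Longrightarrow> order_conditions b1 b2 b3 (h i *\<^sub>R J i)"
  shows "of_order 4 (\<lambda>i. (dpg_step F b1 b2 b3 (h i) (w i) - w i - model i (h i)) /\<^sub>R h i)"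
proof -
  define \<Phi> where "\<Phi> p i = phi p (h i *\<^sub>R J i)" for p i
  define B2 where "B2 i = b2 (h i *\<^sub>R J i)" for i
  define B3 where "B3 i = b3 (h i *\<^sub>R J i)" for i
  define D2 where "D2 i = stage2 F (h i) (w i) - w i" for i
  define D3 where "D3 i = stage3 F (h i) (w i) - w i" for i
  have D2_eq: "D2 i = h i *\<^sub>R \<Phi> 2 i (f i)" for i
    by (simp add: D2_def stage2_def nonlin_def \<Phi>_def)
  have D3_eq: "D3 i = h i *\<^sub>R (J i (D2 i) + f i)" for i
    by (simp add: D3_def D2_def stage3_def nonlin_def blinfun.diff_right algebra_simps)

  have phi0: "of_order 0 (\<Phi> p)" for p
    unfolding \<Phi>_def[abs_def] by (rule of_order_phi)
  have weights: "B2 i = 16 *\<^sub>R \<Phi> 3 i - 48 *\<^sub>R \<Phi> 4 i" "B3 i = 12 *\<^sub>R \<Phi> 4 i - 2 *\<^sub>R \<Phi> 3 i"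
    "(1/4) *\<^sub>R B2 i + B3 i = 2 *\<^sub>R \<Phi> 3 i" "(1/8) *\<^sub>R B2 i + B3 i = 6 *\<^sub>R \<Phi> 4 i"
    "b1 (h i *\<^sub>R J i) + B2 i + B3 i = \<Phi> 1 i"
    if i: "i \<in> I" for i
  proof -
    show c: "(1/4) *\<^sub>R B2 i + B3 i = 2 *\<^sub>R \<Phi> 3 i" "(1/8) *\<^sub>R B2 i + B3 i = 6 *\<^sub>R \<Phi> 4 i"
      "b1 (h i *\<^sub>R J i) + B2 i + B3 i = \<Phi> 1 i"
      using oc[OF i] by (simp_all add: order_conditions_def B2_def B3_def \<Phi>_def)
    \<comment> \<open>The last two order conditions form an invertible linear system for \<open>b\<^sub>2\<close> and \<open>b\<^sub>3\<close>; solving it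
      shows that the weights are bounded.\<close>
    have "B2 i = 8 *\<^sub>R (((1/4) *\<^sub>R B2 i + B3 i) - ((1/8) *\<^sub>R B2 i + B3 i))"
      by (simp add: algebra_simps flip: scaleR_add_left scaleR_diff_left)
    then show B2: "B2 i = 16 *\<^sub>R \<Phi> 3 i - 48 *\<^sub>R \<Phi> 4 i"
      unfolding c by (simp add: algebra_simps)
    have "B3 i = 2 *\<^sub>R \<Phi> 3 i - (1/4) *\<^sub>R B2 i" using c(1) by (simp add: algebra_simps)
    then show "B3 i = 12 *\<^sub>R \<Phi> 4 i - 2 *\<^sub>R \<Phi> 3 i"
      unfolding B2 using scaleR_add_left[of 2 2 "\<Phi> 3 i"] by (simp add: scaleR_diff_right)
  qed
  have B: "of_order 0 B2" "of_order 0 B3"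
    by (rule of_order_cong[OF of_order_diff[OF of_order_scaleR_const[OF phi0] of_order_scaleR_const[OF phi0]]],
        erule weights)+

  have hk: "of_order k (\<lambda>i. h i ^ k)" for k by (rule of_order_h_power)
  have hf: "of_order 1 (\<lambda>i. h i *\<^sub>R f i)"
    by (rule of_order_scaleR[OF of_order_h of_order_coefficients(1)]) simp
  have h2Jf: "of_order 2 (\<lambda>i. h i ^ 2 *\<^sub>R J i (f i))"
    by (rule of_order_scaleR[OF hk of_order_Jf]) simp
  \<comment> \<open>Here \<open>1/2\<close> and \<open>1/6\<close> are the first two coefficients \<open>1 / fact (k + 2)\<close> of \<open>\<phi>\<^sub>2\<close>.\<close>
  have P2: "of_order 2 (\<lambda>i. \<Phi> 2 i - ((1/2) *\<^sub>R id_blinfun + (h i / 6) *\<^sub>R J i))"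
    using phi_expansion[of 2 2]
    by (rule of_order_cong) (simp add: \<Phi>_def eval_nat_numeral compose_id_blinfun)
  have "of_order 3 (\<lambda>i. h i *\<^sub>R (\<Phi> 2 i - ((1/2) *\<^sub>R id_blinfun + (h i / 6) *\<^sub>R J i)) (f i))"
    by (rule of_order_scaleR[OF of_order_h of_order_apply[OF P2 of_order_coefficients(1) order_refl]]) simp
  hence r2: "of_order 3 (\<lambda>i. D2 i - ((1/2 * h i) *\<^sub>R f i + (1/6 * h i ^ 2) *\<^sub>R J i (f i)))"
    by (rule of_order_cong)
       (simp add: D2_eq blinfun.diff_left blinfun.add_left blinfun.scaleR_left algebra_simps power2_eq_square)
  have r2': "of_order 2 (\<lambda>i. D2 i - (1/2) *\<^sub>R (h i *\<^sub>R f i))"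
    by (rule of_order_cong[OF of_order_add[OF of_order_mono[OF r2] of_order_scaleR_const[OF h2Jf, where c = "1/6"]]]) simp_all
  have o2: "of_order 1 D2"
    by (rule of_order_cong[OF of_order_add[OF of_order_mono[OF r2'] of_order_scaleR_const[OF hf, where c = "1/2"]]]) simp_all
  have "of_order 3 (\<lambda>i. h i *\<^sub>R J i (D2 i - (1/2) *\<^sub>R (h i *\<^sub>R f i)))"
    by (rule of_order_scaleR[OF of_order_h of_order_J[OF r2']]) simp
  hence r3: "of_order 3 (\<lambda>i. D3 i - ((1 * h i) *\<^sub>R f i + (1/2 * h i ^ 2) *\<^sub>R J i (f i)))"
    by (rule of_order_cong)
       (simp add: D3_eq blinfun.diff_right blinfun.scaleR_right algebra_simps power2_eq_square)
  have o3: "of_order 1 D3"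
    by (rule of_order_cong[OF of_order_add[OF of_order_add[OF of_order_mono[OF r3] hf]
              of_order_scaleR_const[OF of_order_mono[OF h2Jf], where c = "1/2"]]]) simp_all
  have near: "\<And>i. i \<in> I \<Longrightarrow> norm (D2 i) < \<rho>" "\<And>i. i \<in> I \<Longrightarrow> norm (D3 i) < \<rho>"
    unfolding D2_def D3_def by (rule stages_near_center; assumption)+

  define G2 where "G2 i = F (w i + D2 i) - f i - J i (D2 i)" for i
  define G3 where "G3 i = F (w i + D3 i) - f i - J i (D3 i)" for i
  define C2 where "C2 i = correction2 F (h i) (w i)" for i
  have G2: "of_order 4 (\<lambda>i. G2 i - (((1/2)\<^sup>2 * h i ^ 2) *\<^sub>R quad_coeff i
      + h i ^ 3 *\<^sub>R ((1/2 * (1/6)) *\<^sub>R H i (f i) (J i (f i)) + ((1/2) ^ 3 / 6) *\<^sub>R K i (f i) (f i) (f i))))"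
    unfolding G2_def by (rule nonlinearity_expansion[OF o2 near(1) of_order_h r2])
  have G3: "of_order 4 (\<lambda>i. G3 i - ((1\<^sup>2 * h i ^ 2) *\<^sub>R quad_coeff i
      + h i ^ 3 *\<^sub>R ((1 * (1/2)) *\<^sub>R H i (f i) (J i (f i)) + (1 ^ 3 / 6) *\<^sub>R K i (f i) (f i) (f i))))"
    unfolding G3_def by (rule nonlinearity_expansion[OF o3 near(2) of_order_h r3])

  have C2: "of_order 4 (\<lambda>i. C2 i + (h i ^ 3 / 48) *\<^sub>R H i (f i) (J i (f i)))"
  proof -
    \<comment> \<open>The correction is \<open>- 1/4\<close> times the increment of the Jacobian, which is \<open>h/2 H f\<close> to leading
      order, applied to \<open>X\<close>, which is \<open>h\<^sup>2/6 J f\<close> to leading order.\<close>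
    define X where "X i = D3 i - 2 *\<^sub>R D2 i" for i
    have X3: "of_order 3 (\<lambda>i. X i - (1/6) *\<^sub>R (h i ^ 2 *\<^sub>R J i (f i)))"
      by (rule of_order_cong[OF of_order_diff[OF r3 of_order_scaleR_const[OF r2, where c = 2]]])
         (simp add: X_def algebra_simps flip: scaleR_add_left)
    have X2: "of_order 2 X"
      by (rule of_order_cong[OF of_order_add[OF of_order_mono[OF X3] of_order_scaleR_const[OF h2Jf, where c = "1/6"]]]) simp_all
    have "of_order 4 (\<lambda>i. (-1/4) *\<^sub>R ((fderiv F (w i + D2 i) - J i - H i (D2 i)) (X i)
        + H i (D2 i - (1/2) *\<^sub>R (h i *\<^sub>R f i)) (X i)
        + H i (h i *\<^sub>R f i) ((1/2) *\<^sub>R (X i - (1/6) *\<^sub>R (h i ^ 2 *\<^sub>R J i (f i))))))"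
      by (intro of_order_scaleR_const of_order_add of_order_apply[OF of_order_remainder(2)[OF o2 near(1)] X2]
          of_order_H[OF r2' X2] of_order_H[OF hf of_order_scaleR_const[OF X3]]) simp_all
    then show ?thesis
    proof (rule of_order_cong)
      fix i assume i: "i \<in> I"
      have "F differentiable (at (stage2 F (h i) (w i)))"
        by (rule differentiable(1)[OF i]) (use near(1)[OF i] in \<open>simp add: D2_def dist_norm norm_minus_commute\<close>)
      hence C2: "C2 i = (-1/4) *\<^sub>R (fderiv F (w i + D2 i) - J i) (X i)"
        by (simp add: C2_def correction2_def fderiv_nonlin X_def D2_def D3_def algebra_simps scaleR_2)
      show "C2 i + (h i ^ 3 / 48) *\<^sub>R H i (f i) (J i (f i)) =
         (-1/4) *\<^sub>R ((fderiv F (w i + D2 i) - J i - H i (D2 i)) (X i)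
        + H i (D2 i - (1/2) *\<^sub>R (h i *\<^sub>R f i)) (X i)
        + H i (h i *\<^sub>R f i) ((1/2) *\<^sub>R (X i - (1/6) *\<^sub>R (h i ^ 2 *\<^sub>R J i (f i)))))"
        unfolding C2 by (simp add: blinfun.add_left blinfun.diff_left blinfun.diff_right blinfun.scaleR_left
            blinfun.scaleR_right algebra_simps power2_eq_square power3_eq_cube)
    qed
  qed

  \<comment> \<open>The correction changes the coefficient \<open>1/12\<close> of \<open>h ^ 3 H f (J f)\<close> into \<open>1/12 - 1/48 = 1/16\<close>.\<close>
  have GC2: "of_order 4 (\<lambda>i. G2 i + C2 i - ((h i ^ 2 / 4) *\<^sub>R quad_coeff i + (h i ^ 3 / 8) *\<^sub>R cubic_coeff i))"
  proof (rule of_order_cong[OF of_order_add[OF G2 C2]])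
    fix i
    have c: "h i ^ 3 / 16 + h i ^ 3 / 48 = h i ^ 3 / 12" by simp
    have "(h i ^ 3 / 12) *\<^sub>R H i (f i) (J i (f i))
        = (h i ^ 3 / 16) *\<^sub>R H i (f i) (J i (f i)) + (h i ^ 3 / 48) *\<^sub>R H i (f i) (J i (f i))"
      unfolding scaleR_add_left[symmetric] c by (rule refl)
    then show "G2 i + C2 i - ((h i ^ 2 / 4) *\<^sub>R quad_coeff i + (h i ^ 3 / 8) *\<^sub>R cubic_coeff i) =
        G2 i - (((1/2)\<^sup>2 * h i ^ 2) *\<^sub>R quad_coeff i + h i ^ 3 *\<^sub>R ((1/2 * (1/6)) *\<^sub>R H i (f i) (J i (f i))
          + ((1/2) ^ 3 / 6) *\<^sub>R K i (f i) (f i) (f i)))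
        + (C2 i + (h i ^ 3 / 48) *\<^sub>R H i (f i) (J i (f i)))"
      by (simp add: cubic_coeff_def scaleR_add_right power_divide)
  qed
  have GC3: "of_order 4 (\<lambda>i. G3 i - (h i ^ 2 *\<^sub>R quad_coeff i + h i ^ 3 *\<^sub>R cubic_coeff i))"
    by (rule of_order_cong[OF G3]) (simp add: cubic_coeff_def algebra_simps)

  have P1: "of_order 4 (\<lambda>i. \<Phi> 1 i - (id_blinfun + (h i / 2) *\<^sub>R J i + (h i ^ 2 / 6) *\<^sub>R (J i o\<^sub>L J i)
       + (h i ^ 3 / 24) *\<^sub>R (J i o\<^sub>L (J i o\<^sub>L J i))))"
    using phi_expansion[of 4 1]
    by (rule of_order_cong) (simp add: \<Phi>_def eval_nat_numeral compose_id_blinfun)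
  have P3: "of_order 2 (\<lambda>i. \<Phi> 3 i - ((1/6) *\<^sub>R id_blinfun + (h i / 24) *\<^sub>R J i))"
    using phi_expansion[of 2 3]
    by (rule of_order_cong) (simp add: \<Phi>_def eval_nat_numeral compose_id_blinfun)
  have P4: "of_order 1 (\<lambda>i. \<Phi> 4 i - (1/24) *\<^sub>R id_blinfun)"
    using phi_expansion[of 1 4] by (rule of_order_cong) (simp add: \<Phi>_def eval_nat_numeral)

  have "of_order 4 (\<lambda>i. (\<Phi> 1 i - (id_blinfun + (h i / 2) *\<^sub>R J i + (h i ^ 2 / 6) *\<^sub>R (J i o\<^sub>L J i)
       + (h i ^ 3 / 24) *\<^sub>R (J i o\<^sub>L (J i o\<^sub>L J i)))) (f i)
     + B2 i (G2 i + C2 i - ((h i ^ 2 / 4) *\<^sub>R quad_coeff i + (h i ^ 3 / 8) *\<^sub>R cubic_coeff i))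
     + B3 i (G3 i - (h i ^ 2 *\<^sub>R quad_coeff i + h i ^ 3 *\<^sub>R cubic_coeff i))
     + 2 *\<^sub>R (h i ^ 2 *\<^sub>R (\<Phi> 3 i - ((1/6) *\<^sub>R id_blinfun + (h i / 24) *\<^sub>R J i)) (quad_coeff i))
     + 6 *\<^sub>R (h i ^ 3 *\<^sub>R (\<Phi> 4 i - (1/24) *\<^sub>R id_blinfun) (cubic_coeff i)))"
    by (intro of_order_add of_order_scaleR_const of_order_apply[OF P1 of_order_coefficients(1)]
        of_order_apply[OF B(1) GC2] of_order_apply[OF B(2) GC3]
        of_order_scaleR[OF hk of_order_apply[OF P3 of_order_quad order_refl]]
        of_order_scaleR[OF hk of_order_apply[OF P4 of_order_cubic order_refl]]) simp_all
  then show ?thesis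
  proof (rule of_order_cong)
    fix i assume i: "i \<in> I"
    have h0: "h i \<noteq> 0" using h_pos[OF i] by simp
    have n2: "nonlin F (w i) (stage2 F (h i) (w i)) = nonlin F (w i) (w i) + G2 i"
      and n3: "nonlin F (w i) (stage3 F (h i) (w i)) = nonlin F (w i) (w i) + G3 i"
      by (simp_all add: nonlin_def G2_def G3_def D2_def D3_def blinfun.diff_right)
    have ex: "op_exp (h i *\<^sub>R J i) (w i) = w i + h i *\<^sub>R \<Phi> 1 i (J i (w i))"
      by (simp add: op_exp_eq_phi_1 \<Phi>_def blinfun.add_left blinfun.scaleR_left blinfun.scaleR_right)
    let ?g = "nonlin F (w i) (w i)"
    have step0: "dpg_step F b1 b2 b3 (h i) (w i) - w i = h i *\<^sub>R (\<Phi> 1 i (J i (w i))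
        + (b1 (h i *\<^sub>R J i) + B2 i + B3 i) ?g + B2 i (G2 i + C2 i) + B3 i (G3 i))"
      by (simp add: dpg_step_def ex n2 n3 B2_def B3_def C2_def blinfun.add_left blinfun.add_right algebra_simps)
    have phi1: "\<Phi> 1 i (J i (w i)) + (b1 (h i *\<^sub>R J i) + B2 i + B3 i) ?g = \<Phi> 1 i (f i)"
      unfolding weights(5)[OF i] by (simp add: nonlin_def blinfun.diff_right)
    have step: "dpg_step F b1 b2 b3 (h i) (w i) - w i
        = h i *\<^sub>R (\<Phi> 1 i (f i) + B2 i (G2 i + C2 i) + B3 i (G3 i))"
      unfolding step0 phi1 ..
    have model: "model i (h i) = h i *\<^sub>R (f i + (h i / 2) *\<^sub>R J i (f i) + (h i ^ 2 / 6) *\<^sub>R J i (J i (f i))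
     + (h i ^ 3 / 24) *\<^sub>R J i (J i (J i (f i)))
     + (h i ^ 2 / 3) *\<^sub>R quad_coeff i + (h i ^ 3 / 12) *\<^sub>R J i (quad_coeff i) + (h i ^ 3 / 4) *\<^sub>R cubic_coeff i)"
      by (simp add: model_def scaleR_add_right power2_eq_square power3_eq_cube power4_eq_xxxx mult.assoc)
    have q: "B2 i ((h i ^ 2 / 4) *\<^sub>R quad_coeff i) + B3 i (h i ^ 2 *\<^sub>R quad_coeff i) = 2 *\<^sub>R (h i ^ 2 *\<^sub>R \<Phi> 3 i (quad_coeff i))"
    proof -
      have "B2 i ((h i ^ 2 / 4) *\<^sub>R quad_coeff i) + B3 i (h i ^ 2 *\<^sub>R quad_coeff i)
          = h i ^ 2 *\<^sub>R ((1/4) *\<^sub>R B2 i + B3 i) (quad_coeff i)"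
        by (simp add: blinfun.add_left blinfun.scaleR_left blinfun.scaleR_right scaleR_add_right)
      then show ?thesis unfolding weights(3)[OF i] by (simp add: blinfun.scaleR_left)
    qed
    have c: "B2 i ((h i ^ 3 / 8) *\<^sub>R cubic_coeff i) + B3 i (h i ^ 3 *\<^sub>R cubic_coeff i) = 6 *\<^sub>R (h i ^ 3 *\<^sub>R \<Phi> 4 i (cubic_coeff i))"
    proof -
      have "B2 i ((h i ^ 3 / 8) *\<^sub>R cubic_coeff i) + B3 i (h i ^ 3 *\<^sub>R cubic_coeff i)
          = h i ^ 3 *\<^sub>R ((1/8) *\<^sub>R B2 i + B3 i) (cubic_coeff i)"
        by (simp add: blinfun.add_left blinfun.scaleR_left blinfun.scaleR_right scaleR_add_right)
      then show ?thesis unfolding weights(4)[OF i] by (simp add: blinfun.scaleR_left)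
    qed
    have B2G: "B2 i (G2 i + C2 i) = B2 i (G2 i + C2 i - ((h i ^ 2 / 4) *\<^sub>R quad_coeff i + (h i ^ 3 / 8) *\<^sub>R cubic_coeff i))
        + B2 i ((h i ^ 2 / 4) *\<^sub>R quad_coeff i) + B2 i ((h i ^ 3 / 8) *\<^sub>R cubic_coeff i)"
      by (simp add: blinfun.diff_right blinfun.add_right)
    have B3G: "B3 i (G3 i) = B3 i (G3 i - (h i ^ 2 *\<^sub>R quad_coeff i + h i ^ 3 *\<^sub>R cubic_coeff i))
        + B3 i (h i ^ 2 *\<^sub>R quad_coeff i) + B3 i (h i ^ 3 *\<^sub>R cubic_coeff i)"
      by (simp add: blinfun.diff_right blinfun.add_right)
    let ?E2 = "B2 i (G2 i + C2 i - ((h i ^ 2 / 4) *\<^sub>R quad_coeff i + (h i ^ 3 / 8) *\<^sub>R cubic_coeff i))"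
    let ?E3 = "B3 i (G3 i - (h i ^ 2 *\<^sub>R quad_coeff i + h i ^ 3 *\<^sub>R cubic_coeff i))"
    have inner: "\<Phi> 1 i (f i) + B2 i (G2 i + C2 i) + B3 i (G3 i)
        = \<Phi> 1 i (f i) + ?E2 + ?E3 + 2 *\<^sub>R (h i ^ 2 *\<^sub>R \<Phi> 3 i (quad_coeff i)) + 6 *\<^sub>R (h i ^ 3 *\<^sub>R \<Phi> 4 i (cubic_coeff i))"
      unfolding q[symmetric] c[symmetric] by (subst B2G, subst B3G) (simp add: add_ac)
    have "(dpg_step F b1 b2 b3 (h i) (w i) - w i - model i (h i)) /\<^sub>R h i
        = \<Phi> 1 i (f i) + ?E2 + ?E3 + 2 *\<^sub>R (h i ^ 2 *\<^sub>R \<Phi> 3 i (quad_coeff i)) + 6 *\<^sub>R (h i ^ 3 *\<^sub>R \<Phi> 4 i (cubic_coeff i))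
          - (f i + (h i / 2) *\<^sub>R J i (f i) + (h i ^ 2 / 6) *\<^sub>R J i (J i (f i))
     + (h i ^ 3 / 24) *\<^sub>R J i (J i (J i (f i)))
     + (h i ^ 2 / 3) *\<^sub>R quad_coeff i + (h i ^ 3 / 12) *\<^sub>R J i (quad_coeff i) + (h i ^ 3 / 4) *\<^sub>R cubic_coeff i)"
      unfolding step inner model scaleR_diff_right[symmetric] using h0 by simp
    also have "\<dots> = (\<Phi> 1 i - (id_blinfun + (h i / 2) *\<^sub>R J i + (h i ^ 2 / 6) *\<^sub>R (J i o\<^sub>L J i)
       + (h i ^ 3 / 24) *\<^sub>R (J i o\<^sub>L (J i o\<^sub>L J i)))) (f i) + ?E2 + ?E3
     + 2 *\<^sub>R (h i ^ 2 *\<^sub>R (\<Phi> 3 i - ((1/6) *\<^sub>R id_blinfun + (h i / 24) *\<^sub>R J i)) (quad_coeff i))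
     + 6 *\<^sub>R (h i ^ 3 *\<^sub>R (\<Phi> 4 i - (1/24) *\<^sub>R id_blinfun) (cubic_coeff i))"
      by (simp add: blinfun.diff_left blinfun.add_left blinfun.scaleR_left scaleR_diff_right scaleR_add_right
          power2_eq_square power3_eq_cube mult.assoc)
    finally show "(dpg_step F b1 b2 b3 (h i) (w i) - w i - model i (h i)) /\<^sub>R h i = \<dots>" .
  qed
qed

end

section \<open>Expansion of the exact solution\<close>

text \<open>To every index belongs the piece \<open>U i\<close> of the exact solution over its step. The estimates along it
  have to be uniform in the local time \<open>s\<close> as well, so pairs \<open>(i, s)\<close> serve as indices.\<close>

locale exact_trajectories =
  base: expansion_points "SIGMA i:I. {0..h i}" "\<lambda>p. h (fst p)" "\<lambda>p. \<epsilon> (fst p)" F "\<lambda>p. w (fst p)" M \<rho>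
  for I :: "'i set" and h \<epsilon> :: "'i \<Rightarrow> real" and F :: "'a::banach \<Rightarrow> 'a" and w :: "'i \<Rightarrow> 'a" and M \<rho> :: real +
  fixes U :: "'i \<Rightarrow> real \<Rightarrow> 'a"
  assumes U_continuous: "i \<in> I \<Longrightarrow> continuous_on {0..h i} (U i)"
    and U_derivative: "i \<in> I \<Longrightarrow> 0 < s \<Longrightarrow> s < h i \<Longrightarrow> (U i has_vector_derivative F (U i s)) (at s)"
    and U_near: "i \<in> I \<Longrightarrow> s \<in> {0..h i} \<Longrightarrow> norm (U i s - w i) < \<rho>"
    and U_start: "i \<in> I \<Longrightarrow> norm (U i 0 - w i) = \<epsilon> i"
begin

text \<open>Integrating over a step gains a factor \<open>h\<close>, by the mean value inequality.\<close>

lemma of_order_integral: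
  fixes e :: "'i \<times> real \<Rightarrow> 'b::real_normed_vector"
  assumes cont: "\<And>i. i \<in> I \<Longrightarrow> continuous_on {0..h i} (\<lambda>s. e (i, s))"
    and deriv: "\<And>i s. i \<in> I \<Longrightarrow> 0 < s \<Longrightarrow> s < h i \<Longrightarrow>
                 ((\<lambda>s. e (i, s)) has_vector_derivative e' (i, s)) (at s)"
    and e': "base.of_order k e'"
  shows "base.of_order k (\<lambda>p. (e p - e (fst p, 0)) /\<^sub>R h (fst p))"
proof -
  obtain C where C: "0 \<le> C"
    "\<And>p. p \<in> (SIGMA i:I. {0..h i}) \<Longrightarrow> norm (e' p) \<le> C * (h (fst p) ^ k + \<epsilon> (fst p))"
    using e' by (rule base.of_orderE) blast
  have "norm ((e p - e (fst p, 0)) /\<^sub>R h (fst p)) \<le> C * (h (fst p) ^ k + \<epsilon> (fst p))"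
    if p: "p \<in> (SIGMA i:I. {0..h i})" for p
  proof -
    obtain i s where pis: "p = (i, s)" "i \<in> I" "0 \<le> s" "s \<le> h i" using p by auto
    let ?B = "C * (h i ^ k + \<epsilon> i)"
    have h: "0 < h i" using base.h_pos[OF p] pis(1) by simp
    have B: "0 \<le> ?B" using C(1) base.scale_nonneg[OF p, of k] pis(1) by simp
    have "norm (e (i, s) - e (i, 0)) \<le> ?B * h i"
    proof (cases "s = 0")
      case True
      then show ?thesis using B h by simp
    next
      case False
      have "norm (e (i, s) - e (i, 0)) \<le> ?B * s - ?B * 0"
      proof (rule differentiable_bound_general)
        show "0 < s" using False pis(3) by simp
        show "continuous_on {0..s} (\<lambda>s. e (i, s))"
          using cont[OF pis(2)] pis(4) by (auto intro: continuous_on_subset)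
        show "((\<lambda>s. e (i, s)) has_vector_derivative e' (i, x)) (at x)" if "0 < x" "x < s" for x
          using deriv[OF pis(2)] that pis(4) by simp
        show "((*) ?B has_vector_derivative ?B) (at x)" for x
          unfolding has_real_derivative_iff_has_vector_derivative[symmetric]
          by (auto intro!: derivative_eq_intros)
        show "norm (e' (i, x)) \<le> ?B" if "0 < x" "x < s" for x
          using C(2)[of "(i, x)"] that pis by simp
      qed (intro continuous_intros)
      also have "\<dots> \<le> ?B * h i" using pis(4) B by (simp add: mult_left_mono)
      finally show ?thesis .
    qed
    moreover have "norm ((e p - e (fst p, 0)) /\<^sub>R h (fst p)) = norm (e (i, s) - e (i, 0)) / h i"
      using h pis(1) by (simp add: divide_inverse mult.commute)
    ultimately show ?thesis using h pis(1) by (simp add: pos_divide_le_eq)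
  qed
  then show ?thesis unfolding base.of_order_def by blast
qed

text \<open>The form of the previous lemma that drives the bootstrap: a quantity that starts below \<open>\<epsilon>\<close> is one
  order better than its derivative.\<close>

lemma of_order_Suc_integral:
  fixes e :: "'i \<times> real \<Rightarrow> 'b::real_normed_vector"
  assumes "\<And>i. i \<in> I \<Longrightarrow> continuous_on {0..h i} (\<lambda>s. e (i, s))"
    and "\<And>i s. i \<in> I \<Longrightarrow> 0 < s \<Longrightarrow> s < h i \<Longrightarrow>
                 ((\<lambda>s. e (i, s)) has_vector_derivative e' (i, s)) (at s)"
    and "base.of_order k e'"
    and start: "\<And>i. i \<in> I \<Longrightarrow> norm (e (i, 0)) \<le> \<epsilon> i"
  shows "base.of_order (Suc k) e"
proof -
  have "base.of_order (Suc k) (\<lambda>p. h (fst p) *\<^sub>R ((e p - e (fst p, 0)) /\<^sub>R h (fst p)))"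
    by (rule base.of_order_scaleR[OF base.of_order_h of_order_integral[OF assms(1-3)]]) simp_all
  moreover have "base.of_order (Suc k) (\<lambda>p. e (fst p, 0))"
    by (rule base.of_order_eps) (auto intro: start)
  ultimately have "base.of_order (Suc k)
      (\<lambda>p. h (fst p) *\<^sub>R ((e p - e (fst p, 0)) /\<^sub>R h (fst p)) + e (fst p, 0))"
    by (rule base.of_order_add)
  then show ?thesis
    by (rule base.of_order_cong) (use base.h_pos in force)
qed

definition deviation :: "'i \<times> real \<Rightarrow> 'a" where
  "deviation p = U (fst p) (snd p) - w (fst p)"

text \<open>Bootstrap: the differential equation for the deviation bounds its derivative by the deviation
  itself, so that each integration improves the expansion by one order. The last integration keeps
  the factor \<open>h\<close> instead of adding the initial value back.\<close>

lemma trajectory_expansion: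
  "base.of_order 4 (\<lambda>p. (deviation p - base.model p (snd p) - deviation (fst p, 0)) /\<^sub>R h (fst p))"
proof -
  let ?I = "SIGMA i:I. {0..h i}"
  note order = base.of_order_coefficients base.of_order_Jf base.of_order_quad base.of_order_cubic
  define f where "f p = F (w (fst p))" for p :: "'i \<times> real"
  define J where "J p = fderiv F (w (fst p))" for p :: "'i \<times> real"
  have of: "base.of_order 0 f" and oJf: "base.of_order 0 (\<lambda>p. J p (f p))"
    using order by (simp_all add: f_def[abs_def] J_def)
  have oJ: "base.of_order k (\<lambda>p. J p (x p))" if "base.of_order k x" for k x
    using base.of_order_J[OF that] by (simp add: J_def)
  have os: "base.of_order 1 (\<lambda>p. snd p)"
    by (rule base.of_order_dominated[OF base.of_order_h, of _ 1]) auto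
  have osk: "base.of_order k (\<lambda>p. snd p ^ k)" for k
    using base.of_order_power[OF os, of k] by simp
  let ?v = deviation
  have v_cont: "continuous_on {0..h i} (\<lambda>s. ?v (i, s))" if "i \<in> I" for i
    unfolding deviation_def using U_continuous[OF that] by (auto intro!: continuous_intros)
  have v_deriv: "((\<lambda>s. ?v (i, s)) has_vector_derivative F (U i s)) (at s)"
    if "i \<in> I" "0 < s" "s < h i" for i s
    unfolding deviation_def using U_derivative[OF that] by (auto intro!: derivative_eq_intros)
  have v_start: "norm (?v (i, 0)) = \<epsilon> i" if "i \<in> I" for i
    using U_start[OF that] by (simp add: deviation_def)
  have v_near: "norm (?v p) < \<rho>" if "p \<in> ?I" for p
    using U_near that by (auto simp: deviation_def)
  have Uv: "U (fst p) (snd p) = w (fst p) + ?v p" for p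
    by (simp add: deviation_def)

  have lip: "norm (F (w (fst p) + ?v p) - f p) \<le> M * norm (?v p)" if "p \<in> ?I" for p
    unfolding f_def
    by (rule norm_diff_le_of_fderiv_bound[OF v_near[OF that] base.differentiable(1)[OF that]
          base.derivative_bound(1)[OF that]])
  have M0: "0 \<le> M" using base.M_ge_1 by simp
  have v0: "base.of_order 0 ?v"
    by (rule base.of_order_bounded[of _ 1]) (use v_near base.rho_le_1 in force)
  have d0: "base.of_order k (\<lambda>p. F (w (fst p) + ?v p) - f p)" if "base.of_order k ?v" for k
    by (rule base.of_order_dominated[OF that lip M0])
  have v1: "base.of_order 1 ?v"
    unfolding One_nat_def
  proof (rule of_order_Suc_integral[where e' = "\<lambda>p. F (w (fst p) + ?v p)"])
    have "base.of_order 0 (\<lambda>p. (F (w (fst p) + ?v p) - f p) + f p)"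
      by (rule base.of_order_add[OF d0[OF v0] of])
    then show "base.of_order 0 (\<lambda>p. F (w (fst p) + ?v p))" by simp
  qed (use v_cont v_deriv v_start in \<open>simp_all add: deviation_def\<close>)

  have v2: "base.of_order 2 (\<lambda>p. ?v p - snd p *\<^sub>R f p)"
    unfolding numeral_2_eq_2
  proof (rule of_order_Suc_integral[where e' = "\<lambda>p. F (w (fst p) + ?v p) - f p"])
    show "base.of_order (Suc 0) (\<lambda>p. F (w (fst p) + ?v p) - f p)"
      using d0[OF v1] by simp
    show "continuous_on {0..h i} (\<lambda>s. ?v (i, s) - snd (i, s) *\<^sub>R f (i, s))" if "i \<in> I" for i
      using v_cont[OF that] by (auto simp: f_def intro!: continuous_intros)
    show "((\<lambda>s. ?v (i, s) - snd (i, s) *\<^sub>R f (i, s)) has_vector_derivative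
        F (w (fst (i, s)) + ?v (i, s)) - f (i, s)) (at s)" if "i \<in> I" "0 < s" "s < h i" for i s
      using v_deriv[OF that] Uv[of "(i, s)"] by (auto simp: f_def intro!: derivative_eq_intros)
  qed (use v_start in simp)

  have v3: "base.of_order 3 (\<lambda>p. ?v p - (snd p *\<^sub>R f p + (snd p ^ 2 / 2) *\<^sub>R J p (f p)))"
    unfolding numeral_3_eq_3
  proof (rule of_order_Suc_integral[where e' = "\<lambda>p. F (w (fst p) + ?v p) - f p - snd p *\<^sub>R J p (f p)"])
    have "base.of_order 2 (\<lambda>p. (F (w (fst p) + ?v p) - f p - J p (?v p)) + J p (?v p - snd p *\<^sub>R f p))"
      using base.of_order_add[OF base.of_order_remainder(1)[OF v1 v_near] oJ[OF v2]]
      by (simp add: f_def J_def)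
    then show "base.of_order (Suc (Suc 0)) (\<lambda>p. F (w (fst p) + ?v p) - f p - snd p *\<^sub>R J p (f p))"
      by (simp add: blinfun.diff_right blinfun.scaleR_right numeral_2_eq_2)
    show "continuous_on {0..h i} (\<lambda>s. ?v (i, s) -
        (snd (i, s) *\<^sub>R f (i, s) + (snd (i, s) ^ 2 / 2) *\<^sub>R J (i, s) (f (i, s))))" if "i \<in> I" for i
      using v_cont[OF that] by (auto simp: f_def J_def intro!: continuous_intros)
    show "((\<lambda>s. ?v (i, s) -
        (snd (i, s) *\<^sub>R f (i, s) + (snd (i, s) ^ 2 / 2) *\<^sub>R J (i, s) (f (i, s)))) has_vector_derivative
        F (w (fst (i, s)) + ?v (i, s)) - f (i, s) - snd (i, s) *\<^sub>R J (i, s) (f (i, s))) (at s)"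
      if "i \<in> I" "0 < s" "s < h i" for i s
      using v_deriv[OF that] Uv[of "(i, s)"] by (auto simp: f_def J_def intro!: derivative_eq_intros)
  qed (use v_start in simp)

  let ?q = base.quad_coeff and ?c = base.cubic_coeff
  have G: "base.of_order 4 (\<lambda>p. F (w (fst p) + ?v p) - f p - J p (?v p)
      - (snd p ^ 2 *\<^sub>R ?q p + snd p ^ 3 *\<^sub>R ?c p))"
  proof (rule base.of_order_cong)
    show "base.of_order 4 (\<lambda>p. F (w (fst p) + ?v p) - F (w (fst p)) - fderiv F (w (fst p)) (?v p)
      - ((1\<^sup>2 * snd p ^ 2) *\<^sub>R ?q p + snd p ^ 3 *\<^sub>R
         ((1 * (1/2)) *\<^sub>R fderiv (fderiv F) (w (fst p)) (F (w (fst p))) (fderiv F (w (fst p)) (F (w (fst p))))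
          + (1 ^ 3 / 6) *\<^sub>R fderiv (fderiv (fderiv F)) (w (fst p)) (F (w (fst p))) (F (w (fst p))) (F (w (fst p))))))"
      by (rule base.nonlinearity_expansion[OF v1 v_near os])
         (use v3 in \<open>simp_all add: f_def J_def\<close>)
  qed (simp add: base.cubic_coeff_def f_def J_def)

  define z' where "z' p = f p + snd p *\<^sub>R J p (f p) + (snd p ^ 2 / 2) *\<^sub>R J p (J p (f p))
     + (snd p ^ 3 / 6) *\<^sub>R J p (J p (J p (f p)))
     + snd p ^ 2 *\<^sub>R ?q p + (snd p ^ 3 / 3) *\<^sub>R J p (?q p) + snd p ^ 3 *\<^sub>R ?c p" for p
  define y where "y p = ?v p - base.model p (snd p)" for p
  define y' where "y' p = F (w (fst p) + ?v p) - z' p" for p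
  have model_const: "base.model (i, s) t = t *\<^sub>R f (i, 0) + (t ^ 2 / 2) *\<^sub>R J (i, 0) (f (i, 0))
     + (t ^ 3 / 6) *\<^sub>R J (i, 0) (J (i, 0) (f (i, 0)))
     + (t ^ 4 / 24) *\<^sub>R J (i, 0) (J (i, 0) (J (i, 0) (f (i, 0))))
     + (t ^ 3 / 3) *\<^sub>R ?q (i, 0) + (t ^ 4 / 12) *\<^sub>R J (i, 0) (?q (i, 0)) + (t ^ 4 / 4) *\<^sub>R ?c (i, 0)" for i s t
    by (simp add: base.model_def f_def J_def base.quad_coeff_def base.cubic_coeff_def)
  have z'_const: "z' (i, s) = f (i, 0) + s *\<^sub>R J (i, 0) (f (i, 0)) + (s ^ 2 / 2) *\<^sub>R J (i, 0) (J (i, 0) (f (i, 0)))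
     + (s ^ 3 / 6) *\<^sub>R J (i, 0) (J (i, 0) (J (i, 0) (f (i, 0))))
     + s ^ 2 *\<^sub>R ?q (i, 0) + (s ^ 3 / 3) *\<^sub>R J (i, 0) (?q (i, 0)) + s ^ 3 *\<^sub>R ?c (i, 0)" for i s
    by (simp add: z'_def f_def J_def base.quad_coeff_def base.cubic_coeff_def)
  have y_cont: "continuous_on {0..h i} (\<lambda>s. y (i, s))" if "i \<in> I" for i
    unfolding y_def model_const snd_conv using v_cont[OF that] by (intro continuous_intros) auto
  have y_deriv: "((\<lambda>s. y (i, s)) has_vector_derivative y' (i, s)) (at s)"
    if "i \<in> I" "0 < s" "s < h i" for i s
  proof -
    have monomial: "((\<lambda>t. (t ^ Suc n / c) *\<^sub>R x) has_vector_derivative (real (Suc n) * s ^ n / c) *\<^sub>R x) (at s)"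
      for n c and x :: 'a
      unfolding divide_inverse by (auto intro!: derivative_eq_intros simp del: power_Suc)
    have "((\<lambda>t. base.model (i, t) t) has_vector_derivative z' (i, s)) (at s)"
      unfolding model_const z'_const
      using monomial[of 0 1] monomial[of 1 2] monomial[of 2 6] monomial[of 3 24] monomial[of 2 3]
        monomial[of 3 12] monomial[of 3 4]
      by (intro has_vector_derivative_add) (simp_all add: eval_nat_numeral)
    from has_vector_derivative_diff[OF v_deriv[OF that] this] show ?thesis
      using Uv[of "(i, s)"] by (simp add: y_def y'_def)
  qed
  have y_start: "norm (y (i, 0)) \<le> \<epsilon> i" if "i \<in> I" for i
    using v_start[OF that] by (simp add: y_def base.model_def)

  \<comment> \<open>The terms of \<open>J (model s)\<close> of degree four in \<open>s\<close>, which the derivative of \<open>model\<close> lacks.\<close>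
  have tail: "base.of_order 4 (\<lambda>p. snd p ^ 4 *\<^sub>R ((1/24) *\<^sub>R J p (J p (J p (J p (f p))))
        + (1/12) *\<^sub>R J p (J p (?q p)) + (1/4) *\<^sub>R J p (?c p)))"
    by (rule base.of_order_scaleR[OF osk, of 0])
       (intro base.of_order_add base.of_order_scaleR_const oJ of base.of_order_quad base.of_order_cubic, simp)
  have y'_eq: "y' p = J p (y p) + ((F (w (fst p) + ?v p) - f p - J p (?v p)
      - (snd p ^ 2 *\<^sub>R ?q p + snd p ^ 3 *\<^sub>R ?c p))
      + snd p ^ 4 *\<^sub>R ((1/24) *\<^sub>R J p (J p (J p (J p (f p))))
        + (1/12) *\<^sub>R J p (J p (?q p)) + (1/4) *\<^sub>R J p (?c p)))" for p
    by (simp add: y'_def y_def z'_def base.model_def blinfun.diff_right blinfun.add_right blinfun.scaleR_right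
        scaleR_add_right flip: f_def J_def)
  have y'_order: "base.of_order k y'" if "base.of_order k y" "k \<le> 4" for k
    unfolding y'_eq[abs_def]
    by (intro base.of_order_add oJ that(1) base.of_order_mono[OF G that(2)] base.of_order_mono[OF tail that(2)])
  \<comment> \<open>\<open>y\<close> differs from the third-order quantity of \<open>v3\<close> by the cubic_coeff and quartic terms of
    \<open>model\<close> only. Feeding this into \<open>y' = J y + O (h ^ 4 + \<epsilon>)\<close> gives order four for \<open>y\<close>, hence for \<open>y'\<close>.\<close>
  have y3: "base.of_order 3 y"
  proof (rule base.of_order_cong)
    show "base.of_order 3 (\<lambda>p. ?v p - (snd p *\<^sub>R f p + (snd p ^ 2 / 2) *\<^sub>R J p (f p))
      - (snd p ^ 3 *\<^sub>R ((1/6) *\<^sub>R J p (J p (f p)) + (1/3) *\<^sub>R ?q p)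
        + snd p ^ 4 *\<^sub>R ((1/24) *\<^sub>R J p (J p (J p (f p))) + (1/12) *\<^sub>R J p (?q p) + (1/4) *\<^sub>R ?c p)))"
    proof (intro base.of_order_diff[OF v3] base.of_order_add)
      show "base.of_order 3 (\<lambda>p. snd p ^ 3 *\<^sub>R ((1/6) *\<^sub>R J p (J p (f p)) + (1/3) *\<^sub>R ?q p))"
        by (rule base.of_order_scaleR[OF osk, of 0])
           (intro base.of_order_add base.of_order_scaleR_const oJ of base.of_order_quad, simp)
      show "base.of_order 3 (\<lambda>p. snd p ^ 4 *\<^sub>R ((1/24) *\<^sub>R J p (J p (J p (f p))) + (1/12) *\<^sub>R J p (?q p)
          + (1/4) *\<^sub>R ?c p))"
        by (rule base.of_order_scaleR[OF osk, of 0])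
           (intro base.of_order_add base.of_order_scaleR_const oJ of base.of_order_quad base.of_order_cubic, simp)
    qed
  qed (simp add: y_def base.model_def scaleR_add_right flip: f_def J_def)
  have "base.of_order (Suc 3) y"
    by (rule of_order_Suc_integral[OF y_cont y_deriv y'_order[OF y3] y_start]) simp_all
  hence "base.of_order 4 y'" by (intro y'_order) simp_all
  from of_order_integral[OF y_cont y_deriv this]
  show ?thesis by (simp add: y_def base.model_def)
qed

end

section \<open>Error propagation over one step\<close>

lemma continuous_on_closed_interval:
  fixes u :: "real \<Rightarrow> 'a::real_normed_vector"
  assumes "0 < T" "continuous_on {0..<T} u" "(u \<longlongrightarrow> u T) (at_left T)"
    and "\<And>t. t \<in> {0<..<T} \<Longrightarrow> (u has_vector_derivative u' t) (at t)"
  shows "continuous_on {0..T} u"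
proof (rule continuous_on_IccI)
  have "continuous_on {0..T/2} u"
    using assms(1,2) by (auto intro: continuous_on_subset)
  then show "(u \<longlongrightarrow> u 0) (at_right 0)"
    using assms(1) by (intro continuous_on_Icc_at_rightD[of 0 "T/2"]) auto
  show "u \<midarrow>t\<rightarrow> u t" if "0 < t" "t < T" for t
    using has_vector_derivative_continuous[OF assms(4)[of t]] that by (simp add: isCont_def)
qed (use assms in auto)

text \<open>The strip is a union over \<open>t < T\<close>, but by continuity it contains the ball about \<open>u T\<close> too.\<close>

lemma ball_subset_strip:
  assumes "0 < T" "(u \<longlongrightarrow> u T) (at_left T)" "t \<in> {0..T}"
  shows "ball (u t) r \<subseteq> strip u T r"
proof
  fix v assume v: "v \<in> ball (u t) r"
  show "v \<in> strip u T r"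
  proof (cases "t = T")
    case False
    then show ?thesis using v assms(3) by (auto simp: strip_def)
  next
    case True
    have "((\<lambda>s. dist (u s) v) \<longlongrightarrow> dist (u T) v) (at_left T)"
      by (intro tendsto_intros assms(2))
    moreover have "dist (u T) v < r" using v True by simp
    ultimately have "\<forall>\<^sub>F s in at_left T. dist (u s) v < r" by (rule order_tendstoD)
    moreover have "\<forall>\<^sub>F s in at_left T. s \<in> {0<..<T}"
      using assms(1) by (rule eventually_at_left_real)
    ultimately have "\<forall>\<^sub>F s in at_left T. dist (u s) v < r \<and> s \<in> {0<..<T}"
      by (rule eventually_conj)
    hence "\<exists>s. dist (u s) v < r \<and> s \<in> {0<..<T}"
      by (rule eventually_happens'[OF trivial_limit_at_left_real])
    then show ?thesis by (auto simp: strip_def intro!: bexI)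
  qed
qed

text \<open>Stability and consistency in one estimate. The uniform constants come from the compactness of the
  exact trajectory: it bounds \<open>F\<close> and hence the speed of \<open>u\<close>, and a ball of radius \<open>\<rho> \<le> r / 2\<close> about
  any \<open>w\<close> close to the trajectory stays inside the strip.\<close>

proposition one_step_error:
  fixes u :: "real \<Rightarrow> 'a::banach" and F :: "'a \<Rightarrow> 'a"
  assumes T: "T > 0" and u_cont: "continuous_on {0..<T} u"
    and ode: "\<And>t. t \<in> {0<..<T} \<Longrightarrow> (u has_vector_derivative F (u t)) (at t)"
    and u_lim: "(u \<longlongrightarrow> u T) (at_left T)" and r: "r > 0"
    and F: "four_times_bounded_differentiable_on F (strip u T r)"
  obtains C \<delta> h0 where "0 \<le> C" "0 < \<delta>" "0 < h0"
    "\<And>h t w. 0 < h \<Longrightarrow> h \<le> h0 \<Longrightarrow> 0 \<le> t \<Longrightarrow> t + h \<le> T \<Longrightarrow> norm (u t - w) \<le> \<delta> \<Longrightarrow>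
       order_conditions b1 b2 b3 (h *\<^sub>R fderiv F w) \<Longrightarrow>
       norm (u (t + h) - dpg_step F b1 b2 b3 h w)
         \<le> norm (u t - w) + C * h * (h ^ 4 + norm (u t - w))"
proof -
  let ?S = "strip u T r"
  have cont: "continuous_on {0..T} u"
    by (rule continuous_on_closed_interval[OF T u_cont u_lim ode])
  have S: "ball (u t) r \<subseteq> ?S" if "t \<in> {0..T}" for t
    by (rule ball_subset_strip[OF T u_lim that])
  have dF: "F differentiable (at v)" "fderiv F differentiable (at v)"
      "fderiv (fderiv F) differentiable (at v)" "fderiv (fderiv (fderiv F)) differentiable (at v)"
    if "v \<in> ?S" for v
    using F that by (auto simp: four_times_bounded_differentiable_on_def)
  obtain M0 where M0: "\<And>v. v \<in> ?S \<Longrightarrow> norm (fderiv F v) \<le> M0 \<and> norm (fderiv (fderiv F) v) \<le> M0 \<and>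
      norm (fderiv (fderiv (fderiv F)) v) \<le> M0 \<and> norm (fderiv (fderiv (fderiv (fderiv F))) v) \<le> M0"
    using F unfolding four_times_bounded_differentiable_on_def by blast
  have uS: "u t \<in> ?S" if "t \<in> {0..T}" for t
    using S[OF that] r by (meson centre_in_ball subsetD)
  have "continuous_on (u ` {0..T}) F"
    by (intro continuous_at_imp_continuous_on ballI differentiable_imp_continuous_within dF(1))
       (use uS in auto)
  hence "compact (F ` u ` {0..T})"
    by (intro compact_continuous_image cont) auto
  then obtain B where B: "\<And>t. t \<in> {0..T} \<Longrightarrow> norm (F (u t)) \<le> B"
    by (meson bounded_iff compact_imp_bounded imageI)
  have B0: "0 \<le> B" using order_trans[OF norm_ge_zero B[of 0]] T by simp
  define M where "M = 1 + \<bar>M0\<bar> + B"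
  define \<rho> where "\<rho> = min 1 (r / 2)"
  define h0 where "h0 = \<rho> / (8 * M\<^sup>2)"
  have M: "1 \<le> M" "M0 \<le> M" "B \<le> M" using B0 by (auto simp: M_def)
  have \<rho>: "0 < \<rho>" "\<rho> \<le> 1" "2 * \<rho> \<le> r" using r by (auto simp: \<rho>_def)
  have h0: "0 < h0" using M(1) \<rho>(1) by (simp add: h0_def)
  have lip: "norm (u (t + s) - u t) \<le> M * s" if "0 \<le> t" "0 \<le> s" "t + s \<le> T" for t s
  proof (cases "s = 0")
    case False
    have "norm (u (t + s) - u t) \<le> M * (t + s) - M * t"
    proof (rule differentiable_bound_general)
      show "t < t + s" using False that by simp
      show "continuous_on {t..t + s} u" using cont that by (auto intro: continuous_on_subset)
      show "(u has_vector_derivative F (u x)) (at x)" if "t < x" "x < t + s" for x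
        using ode that \<open>0 \<le> t\<close> \<open>t + s \<le> T\<close> by simp
      show "((*) M has_vector_derivative M) (at x)" for x
        unfolding has_real_derivative_iff_has_vector_derivative[symmetric]
        by (auto intro!: derivative_eq_intros)
      show "norm (F (u x)) \<le> M" if "t < x" "x < t + s" for x
        using B[of x] M(3) that \<open>0 \<le> t\<close> \<open>t + s \<le> T\<close> by simp
    qed (intro continuous_intros)
    then show ?thesis by (simp add: algebra_simps)
  qed simp
  \<comment> \<open>An index \<open>i = (h, t, w)\<close> is an admissible step from \<open>w\<close> at time \<open>t\<close>.\<close>
  define I where "I = {i. 0 < fst i \<and> fst i \<le> h0 \<and> 0 \<le> fst (snd i) \<and> fst (snd i) + fst i \<le> T
      \<and> norm (u (fst (snd i)) - snd (snd i)) \<le> \<rho> / 2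
      \<and> order_conditions b1 b2 b3 (fst i *\<^sub>R fderiv F (snd (snd i)))}"
  define h where "h i = fst i" for i :: "real \<times> real \<times> 'a"
  define t where "t i = fst (snd i)" for i :: "real \<times> real \<times> 'a"
  define w where "w i = snd (snd i)" for i :: "real \<times> real \<times> 'a"
  define \<epsilon> where "\<epsilon> i = norm (u (t i) - w i)" for i
  have I: "0 < h i" "h i \<le> h0" "0 \<le> t i" "t i + h i \<le> T" "\<epsilon> i \<le> \<rho> / 2"
    "order_conditions b1 b2 b3 (h i *\<^sub>R fderiv F (w i))" if "i \<in> I" for i
    using that by (auto simp: I_def h_def t_def w_def \<epsilon>_def)
  have M2h: "8 * M ^ 2 * h i \<le> \<rho>" if "i \<in> I" for i
    using I(2)[OF that] M(1) by (simp add: h0_def pos_le_divide_eq mult_ac)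
  have Mh: "M * h i \<le> \<rho> / 8" if "i \<in> I" for i
  proof -
    have "M * h i \<le> M\<^sup>2 * h i"
      using M(1) I(1)[OF that] by (intro mult_right_mono) (auto simp: self_le_power)
    then show ?thesis using M2h[OF that] by simp
  qed
  have h1: "h i \<le> 1" if "i \<in> I" for i
  proof -
    have "1 * h i \<le> M * h i" using M(1) I(1)[OF that] by (intro mult_right_mono) auto
    then show ?thesis using Mh[OF that] \<rho> by simp
  qed
  have near: "ball (w i) \<rho> \<subseteq> ?S" if i: "i \<in> I" for i
  proof
    fix v assume "v \<in> ball (w i) \<rho>"
    hence "dist (u (t i)) v < \<rho> / 2 + \<rho>"
      using I(5)[OF i] dist_triangle[of "u (t i)" v "w i"] by (simp add: \<epsilon>_def dist_norm)
    hence "v \<in> ball (u (t i)) r" using \<rho> by simp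
    then show "v \<in> ?S" using S[of "t i"] I[OF i] by auto
  qed
  interpret exact_trajectories I h \<epsilon> F w M \<rho> "\<lambda>i s. u (t i + s)"
  proof unfold_locales
    fix p assume p: "p \<in> (SIGMA i:I. {0..h i})"
    then have i: "fst p \<in> I" by auto
    show "0 < h (fst p)" "h (fst p) \<le> 1" "0 \<le> \<epsilon> (fst p)" "\<epsilon> (fst p) \<le> 1" "8 * M\<^sup>2 * h (fst p) \<le> \<rho>"
      using I(1,5)[OF i] h1[OF i] M2h[OF i] \<rho> by (auto simp: \<epsilon>_def)
    have "norm (F (u (t (fst p)) + (w (fst p) - u (t (fst p)))) - F (u (t (fst p))))
        \<le> M0 * norm (w (fst p) - u (t (fst p)))"
    proof (rule norm_diff_le_of_fderiv_bound[where \<rho> = r])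
      show "norm (w (fst p) - u (t (fst p))) < r"
        using I(5)[OF i] \<rho> by (simp add: \<epsilon>_def norm_minus_commute)
      have "ball (u (t (fst p))) r \<subseteq> ?S" using I[OF i] by (intro S) auto
      then show "F differentiable (at v)" "norm (fderiv F v) \<le> M0" if "v \<in> ball (u (t (fst p))) r" for v
        using dF(1) M0 that by auto
    qed
    also have "\<dots> \<le> \<bar>M0\<bar> * 1"
      using I(5)[OF i] \<rho> by (intro mult_mono) (auto simp: \<epsilon>_def norm_minus_commute)
    finally have "norm (F (w (fst p)) - F (u (t (fst p)))) \<le> \<bar>M0\<bar>" by simp
    moreover have "norm (F (u (t (fst p)))) \<le> B" using I[OF i] by (intro B) auto
    ultimately show "norm (F (w (fst p))) \<le> M"
      using norm_triangle_sub[of "F (w (fst p))" "F (u (t (fst p)))"] by (simp add: M_def)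
    fix v assume "v \<in> ball (w (fst p)) \<rho>"
    hence v: "v \<in> ?S" using near[OF i] by auto
    show "F differentiable (at v)" "fderiv F differentiable (at v)"
      "fderiv (fderiv F) differentiable (at v)" "fderiv (fderiv (fderiv F)) differentiable (at v)"
      by (rule dF[OF v])+
    show "norm (fderiv F v) \<le> M" "norm (fderiv (fderiv F) v) \<le> M"
      "norm (fderiv (fderiv (fderiv F)) v) \<le> M" "norm (fderiv (fderiv (fderiv (fderiv F))) v) \<le> M"
      using M0[OF v] M(2) by auto
  next
    fix i assume i: "i \<in> I"
    show "continuous_on {0..h i} (\<lambda>s. u (t i + s))"
      by (rule continuous_on_compose2[OF cont]) (use I[OF i] in \<open>auto intro!: continuous_intros\<close>)
    show "norm (u (t i + 0) - w i) = \<epsilon> i" by (simp add: \<epsilon>_def)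
    fix s :: real
    show "((\<lambda>s. u (t i + s)) has_vector_derivative F (u (t i + s))) (at s)" if "0 < s" "s < h i"
    proof -
      have "(u has_vector_derivative F (u (t i + s))) (at (t i + s))"
        using I[OF i] that by (intro ode) auto
      moreover have "((\<lambda>s. t i + s) has_vector_derivative 1) (at s)"
        by (auto intro!: derivative_eq_intros)
      ultimately show ?thesis
        using vector_diff_chain_at[where f = "\<lambda>s. t i + s" and g = u and x = s and f' = 1]
        by (simp add: o_def)
    qed
    show "norm (u (t i + s) - w i) < \<rho>" if s: "s \<in> {0..h i}"
    proof -
      have "norm (u (t i + s) - u (t i)) \<le> M * s" using I[OF i] s by (intro lip) auto
      also have "\<dots> \<le> M * h i" using s M(1) by simp
      also have "\<dots> \<le> \<rho> / 8" by (rule Mh[OF i])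
      finally have "norm (u (t i + s) - u (t i)) \<le> \<rho> / 8" .
      moreover have "norm (u (t i + s) - w i) \<le> norm (u (t i + s) - u (t i)) + norm (u (t i) - w i)"
        using norm_triangle_ineq[of "u (t i + s) - u (t i)" "u (t i) - w i"] by simp
      ultimately show ?thesis using I(5)[OF i] \<rho>(1) by (simp add: \<epsilon>_def)
    qed
  qed (use M \<rho> in auto)
  have "base.of_order 4 (\<lambda>p.
      (deviation p - base.model p (snd p) - deviation (fst p, 0)) /\<^sub>R h (fst p)
      - (dpg_step F b1 b2 b3 (h (fst p)) (w (fst p)) - w (fst p) - base.model p (h (fst p))) /\<^sub>R h (fst p))"
    by (intro base.of_order_diff trajectory_expansion base.dpg_step_expansion) (auto intro: I(6))
  then obtain C where C: "0 \<le> C" "\<And>p. p \<in> (SIGMA i:I. {0..h i}) \<Longrightarrow> norm (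
      (deviation p - base.model p (snd p) - deviation (fst p, 0)) /\<^sub>R h (fst p)
      - (dpg_step F b1 b2 b3 (h (fst p)) (w (fst p)) - w (fst p) - base.model p (h (fst p))) /\<^sub>R h (fst p))
      \<le> C * (h (fst p) ^ 4 + \<epsilon> (fst p))"
    by (rule base.of_orderE) blast
  have step: "norm (u (t i + h i) - dpg_step F b1 b2 b3 (h i) (w i)) \<le> \<epsilon> i + C * h i * (h i ^ 4 + \<epsilon> i)"
    if i: "i \<in> I" for i
  proof -
    let ?y = "dpg_step F b1 b2 b3 (h i) (w i)"
    have h: "0 < h i" by (rule I(1)[OF i])
    \<comment> \<open>\<open>model\<close> cancels between the two expansions.\<close>
    define x where "x = (u (t i + h i) - ?y) - (u (t i) - w i)"
    have dev: "deviation (i, s) = u (t i + s) - w i" for s by (simp add: deviation_def)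
    have "(deviation (i, h i) - m - deviation (i, 0)) /\<^sub>R h i - (?y - w i - m) /\<^sub>R h i = x /\<^sub>R h i" for m
      unfolding scaleR_diff_right[symmetric] dev x_def by (simp add: algebra_simps)
    hence "norm (x /\<^sub>R h i) \<le> C * (h i ^ 4 + \<epsilon> i)"
      using C(2)[of "(i, h i)"] i h
      by simp
    hence "norm x \<le> C * (h i ^ 4 + \<epsilon> i) * h i"
      using h by (simp add: divide_inverse[symmetric] pos_divide_le_eq mult.commute[of "inverse (h i)"])
    moreover have "norm (u (t i + h i) - ?y) \<le> norm (u (t i) - w i) + norm x"
      using norm_triangle_ineq[of "u (t i) - w i" x] by (simp add: x_def)
    ultimately show ?thesis by (simp add: \<epsilon>_def mult_ac)
  qed
  show thesis
  proof (rule that[OF C(1) _ h0])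
    show "0 < \<rho> / 2" using \<rho> by simp
    fix h' t' w'
    assume "0 < h'" "h' \<le> h0" "0 \<le> t'" "t' + h' \<le> T" "norm (u t' - w') \<le> \<rho> / 2"
      "order_conditions b1 b2 b3 (h' *\<^sub>R fderiv F w')"
    hence "(h', t', w') \<in> I" by (simp add: I_def)
    from step[OF this] show "norm (u (t' + h') - dpg_step F b1 b2 b3 h' w')
         \<le> norm (u t' - w') + C * h' * (h' ^ 4 + norm (u t' - w'))"
      by (simp add: h_def t_def w_def \<epsilon>_def)
  qed
qed

section \<open>Convergence\<close>

text \<open>The scheme is explicit, so the data determine the run. For a fixed step size the error is
  therefore a single number at each grid point, whatever run is considered.\<close>

lemma dpg_solution_eq_iterate:
  assumes "dpg_solution F b1 b2 b3 u0 h N x" "n \<le> N"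
  shows "x n = (dpg_step F b1 b2 b3 h ^^ n) u0"
  using assms(2)
proof (induction n)
  case 0
  then show ?case using assms(1) by (simp add: dpg_solution_def)
next
  case (Suc n)
  then show ?case using assms(1) by (simp add: dpg_solution_def)
qed

theorem theorem4:
  fixes u :: "real \<Rightarrow> 'a::banach"
    and F :: "'a \<Rightarrow> 'a"
    and u0 :: 'a
    and T r C\<^sub>0 \<omega> C\<^sub>S :: real
    and b1 b2 b3 :: "('a \<Rightarrow>\<^sub>L 'a) \<Rightarrow> ('a \<Rightarrow>\<^sub>L 'a)"
  assumes "T > 0"
    and "u 0 = u0"
    and "continuous_on {0..<T} u"
    and "u C1_differentiable_on {0<..<T}"
    and "\<And>t. t \<in> {0<..<T} \<Longrightarrow> (u has_vector_derivative F (u t)) (at t)"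
    and "(u \<longlongrightarrow> u T) (at_left T)"
    and "r > 0"
    and "four_times_bounded_differentiable_on F (strip u T r)"
    and "\<And>v. v \<in> strip u T r \<Longrightarrow> generates (fderiv F v) (\<lambda>t. op_exp (t *\<^sub>R fderiv F v))"
    and "\<And>v t. v \<in> strip u T r \<Longrightarrow> t \<ge> 0 \<Longrightarrow>
           norm (op_exp (t *\<^sub>R fderiv F v)) \<le> C\<^sub>0 * exp (\<omega> * t)"
  shows "\<exists>C. \<forall>N\<ge>1. \<forall>h x. h = T / real N \<longrightarrow>
           dpg_solution F b1 b2 b3 u0 h N x \<longrightarrow>
           (\<forall>n<N. order_conditions b1 b2 b3 (h *\<^sub>R fderiv F (x n))) \<longrightarrow>
           stable_products F h N C\<^sub>S x \<longrightarrow>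
           (\<forall>n\<le>N. norm (x n - u (real n * h)) \<le> C * h ^ 4)"
proof -
  obtain C \<delta> h0 where C: "0 \<le> C" and \<delta>: "0 < \<delta>" and h0: "0 < h0"
    and step: "\<And>h t w. 0 < h \<Longrightarrow> h \<le> h0 \<Longrightarrow> 0 \<le> t \<Longrightarrow> t + h \<le> T \<Longrightarrow> norm (u t - w) \<le> \<delta> \<Longrightarrow>
       order_conditions b1 b2 b3 (h *\<^sub>R fderiv F w) \<Longrightarrow>
       norm (u (t + h) - dpg_step F b1 b2 b3 h w)
         \<le> norm (u t - w) + C * h * (h ^ 4 + norm (u t - w))"
    by (rule one_step_error[OF assms(1,3,5,6,7,8), where ?b1.0 = b1 and ?b2.0 = b2 and ?b3.0 = b3])
       (assumption, rule that)
  define E where "E = exp (C * T)"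
  define h1 where "h1 = min (min h0 1) (\<delta> / E)"
  have E: "1 \<le> E" using C assms(1) by (simp add: E_def)
  have h1: "0 < h1" using h0 \<delta> E by (simp add: h1_def)
  have fine: "norm (x n - u (real n * h)) \<le> E * h ^ 4"
    if N: "N \<ge> 1" "h = T / real N" "h \<le> h1"
      and x: "dpg_solution F b1 b2 b3 u0 h N x" "\<forall>n<N. order_conditions b1 b2 b3 (h *\<^sub>R fderiv F (x n))"
      and n: "n \<le> N" for N h x n
  proof -
    have h: "0 < h" "h \<le> h0" "h \<le> 1" "h \<le> \<delta> / E" using N assms(1) by (auto simp: h1_def)
    have hN: "h * real N = T" using N by simp
    have growth: "(1 + C * h) ^ n \<le> E" if "n \<le> N" for n
    proof -
      have "(1 + C * h) ^ n \<le> exp (C * h) ^ n"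
        using C h(1) exp_ge_add_one_self[of "C * h"] by (intro power_mono) auto
      also have "\<dots> = exp (C * h * real n)" by (simp add: exp_of_nat_mult mult.commute)
      also have "\<dots> \<le> E"
        using C h(1) that mult_left_mono[of "real n" "real N" "C * h"] hN by (simp add: E_def mult.assoc)
      finally show ?thesis .
    qed
    \<comment> \<open>This bound is the solution of \<open>e\<^sub>n\<^sub>+\<^sub>1 = (1 + C h) e\<^sub>n + C h ^ 5\<close>, \<open>e\<^sub>0 = 0\<close>.\<close>
    have "norm (u (real n * h) - x n) \<le> ((1 + C * h) ^ n - 1) * h ^ 4"
      using n
    proof (induction n)
      case 0
      then show ?case using x(1) assms(2) by (simp add: dpg_solution_def)
    next
      case (Suc n)
      let ?e = "norm (u (real n * h) - x n)"
      have IH: "?e \<le> ((1 + C * h) ^ n - 1) * h ^ 4" using Suc by simp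
      also have "\<dots> \<le> E * h ^ 4"
        using growth[of n] Suc.prems h(1) by (intro mult_right_mono) auto
      also have "\<dots> \<le> E * h ^ 1"
        using E h by (intro mult_left_mono power_decreasing) auto
      also have "\<dots> \<le> \<delta>" using h(4) E by (simp add: pos_le_divide_eq mult.commute)
      finally have e: "?e \<le> \<delta>" .
      have t: "real n * h + h = real (Suc n) * h" by (simp add: algebra_simps)
      have "h * real (Suc n) \<le> h * real N" using Suc.prems h(1) by (intro mult_left_mono) auto
      hence tT: "real n * h + h \<le> T" unfolding hN by (simp add: algebra_simps)
      have xs: "x (Suc n) = dpg_step F b1 b2 b3 h (x n)" and oc: "order_conditions b1 b2 b3 (h *\<^sub>R fderiv F (x n))"
        using x Suc.prems by (auto simp: dpg_solution_def)
      have "norm (u (real (Suc n) * h) - x (Suc n)) \<le> ?e + C * h * (h ^ 4 + ?e)"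
        using step[OF h(1,2) _ tT e oc] h(1) unfolding t xs by simp
      also have "\<dots> = (1 + C * h) * ?e + C * h * h ^ 4" by (simp add: algebra_simps)
      also have "\<dots> \<le> (1 + C * h) * (((1 + C * h) ^ n - 1) * h ^ 4) + C * h * h ^ 4"
        using C h(1) IH by (intro add_right_mono mult_left_mono) auto
      also have "\<dots> = ((1 + C * h) ^ Suc n - 1) * h ^ 4" by (simp add: algebra_simps)
      finally show ?case .
    qed
    also have "\<dots> \<le> E * h ^ 4" using growth[OF n] by (intro mult_right_mono) auto
    finally show ?thesis by (simp add: norm_minus_commute)
  qed
  \<comment> \<open>On the coarse grids, with \<open>h > h1\<close>, the sum of all scaled errors serves as the constant.\<close>
  define err where "err N n = norm ((dpg_step F b1 b2 b3 (T / real N) ^^ n) u0 - u (real n * (T / real N)))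
      / (T / real N) ^ 4" for N n :: nat
  define N0 where "N0 = nat \<lceil>T / h1\<rceil>"
  define C' where "C' = (\<Sum>N\<le>N0. \<Sum>n\<le>N. err N n)"
  have err_nonneg: "0 \<le> err N n" for N n by (simp add: err_def)
  have C': "0 \<le> C'" unfolding C'_def by (intro sum_nonneg err_nonneg)
  have coarse: "norm (x n - u (real n * h)) \<le> C' * h ^ 4"
    if N: "N \<ge> 1" "h = T / real N" "\<not> h \<le> h1"
      and x: "dpg_solution F b1 b2 b3 u0 h N x" and n: "n \<le> N" for N h x n
  proof -
    have h: "0 < h" using N assms(1) by simp
    have "h1 * real N < h * real N" using N by (intro mult_strict_right_mono) auto
    also have "\<dots> = T" using N by simp
    finally have "real N < T / h1" using h1 by (simp add: pos_less_divide_eq mult.commute)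
    hence "N \<le> N0" unfolding N0_def by linarith
    hence "(\<Sum>n\<le>N. err N n) \<le> C'"
      unfolding C'_def by (intro member_le_sum[of N "{..N0}" "\<lambda>N. \<Sum>n\<le>N. err N n"] sum_nonneg err_nonneg) auto
    moreover have "err N n \<le> (\<Sum>n\<le>N. err N n)"
      using n by (intro member_le_sum err_nonneg) auto
    ultimately have "err N n \<le> C'" by simp
    moreover have "err N n = norm (x n - u (real n * h)) / h ^ 4"
      using dpg_solution_eq_iterate[OF x n] N(2) by (simp add: err_def)
    ultimately show ?thesis
      using pos_divide_le_eq[OF zero_less_power[OF h, of 4]] by simp
  qed
  show ?thesis
  proof (intro exI[of _ "E + C'"] allI impI)
    fix N h x n
    assume *: "1 \<le> N" "h = T / real N" "dpg_solution F b1 b2 b3 u0 h N x"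
      "\<forall>n<N. order_conditions b1 b2 b3 (h *\<^sub>R fderiv F (x n))" "n \<le> N"
    have "norm (x n - u (real n * h)) \<le> max (E * h ^ 4) (C' * h ^ 4)"
      using fine[OF *(1,2) _ *(3,4,5)] coarse[OF *(1,2) _ *(3,5)] by (cases "h \<le> h1") auto
    also have "\<dots> \<le> (E + C') * h ^ 4"
      using E C' by (simp add: distrib_right)
    finally show "norm (x n - u (real n * h)) \<le> (E + C') * h ^ 4" .
  qed
qed

end
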